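(* Let $H$ be a separable complex Hilbert space, $A$ a strictly positive selfadjoint operator on $H$, and $f:\sigma(A)\to[0,\infty)$ a continuous function. Let $S(t)=e^{t\mathbb{A}}$ be the contraction semigroup on $\mathcal{H}=H^1\times H$ generated by the operator $\mathbb{A}(u,v)=(v,-Au-f(A)v)$ defined in the context, and let $\mathfrak{Z}=\{s\in\sigma(A): f(s)=0\}$. Then $S(t)$ is semiuniformly stable if and only if $$\mathfrak{Z}=\emptyset\qquad\text{and}\qquad\sup_{s\in\sigma(A)}\frac{f(s)}{s}<\infty .$$
   Context: $(H,\langle\cdot,\cdot\rangle,\|\cdot\|)$ is a separable complex Hilbert space and $A:\mathrm{dom}(A)\subset H\to H$ is a strictly positive selfadjoint linear operator (so $\sigma(A)$ is a nonempty closed subset of $(0,\infty)$; $A$ may be bounded or unbounded and $A^{-1}$ is not necessarily compact). $f:\sigma(A)\to[0,\infty)$ is continuous, and $f(A)=\int_{\sigma(A)}f(s)\,dE_A(s)$ is the selfadjoint operator given by the functional calculus, $E_A$ being the spectral measure of $A$. For $r>0$, $H^r=\mathrm{dom}(A^{r/2})$ with norm $\|u\|_r=\|A^{r/2}u\|$. The phase space is $\mathcal{H}=H^1\times H$ with norm $\|(u,v)\|_{\mathcal{H}}^2=\|u\|_1^2+\|v\|^2$. The operator $\mathbb{A}$ is $\mathbb{A}(u,v)=(v,\,-(Au+f(A)v))$ with domain $\mathrm{dom}(\mathbb{A})=\{(u,v)\in\mathcal{H}: v\in H^1,\ Au+f(A)v\in H\}$. Here, when $u\notin\mathrm{dom}(A)$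 or $v\notin\mathrm{dom}(f(A))$, $Au$ and $f(A)v$ are understood by duality, as the functionals $w\mapsto\langle Aw,u\rangle$ on $\mathrm{dom}(A)$ and $w\mapsto\langle f(A)w,v\rangle$ on $\mathrm{dom}(f(A))$; thus $Au+f(A)v\in H$ means that there is $h\in H$ (then denoted $Au+f(A)v$) with $\langle Aw,u\rangle+\langle f(A)w,v\rangle=\langle w,h\rangle$ for all $w\in\mathrm{dom}(A)\cap\mathrm{dom}(f(A))$. The operator $\mathbb{A}$ generates a strongly continuous contraction semigroup $S(t)=e^{t\mathbb{A}}$ on $\mathcal{H}$. $S(t)$ is called semiuniformly stable if there exists a function $\psi:[0,\infty)\to[0,\infty)$ vanishing at infinity such that $\|S(t)z_0\|_{\mathcal{H}}\le\psi(t)\|\mathbb{A}z_0\|_{\mathcal{H}}$ for all $z_0\in\mathrm{dom}(\mathbb{A})$ and all $t\ge 0$. *)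

theory Defs
  imports "HOL-Analysis.Analysis"
begin

section \<open>Complex Hilbert spaces\<close>

text \<open>
  The topology and the norm are those of the underlying real inner product space, whose inner
  product is the real part of the complex one. The complex inner product is linear in its first
  argument.
\<close>

class complex_inner = real_inner +
  fixes scaleC :: "complex \<Rightarrow> 'a \<Rightarrow> 'a" (infixr "*\<^sub>C" 75)
    and cinner :: "'a \<Rightarrow> 'a \<Rightarrow> complex"
  assumes scaleC_of_real: "complex_of_real r *\<^sub>C x = r *\<^sub>R x"
    and scaleC_add_right: "c *\<^sub>C (x + y) = c *\<^sub>C x + c *\<^sub>C y"
    and scaleC_add_left: "(c + d) *\<^sub>C x = c *\<^sub>C x + d *\<^sub>C x"
    and scaleC_scaleC: "c *\<^sub>C (d *\<^sub>C x) = (c * d) *\<^sub>C x"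
    and cinner_add_left: "cinner (x + y) z = cinner x z + cinner y z"
    and cinner_scaleC_left: "cinner (c *\<^sub>C x) y = c * cinner x y"
    and cinner_commute: "cinner x y = cnj (cinner y x)"
    and Re_cinner: "Re (cinner x y) = inner x y"

class chilbert_space = complex_inner + complete_space

instantiation prod :: (complex_inner, complex_inner) complex_inner
begin

definition scaleC_prod :: "complex \<Rightarrow> 'a \<times> 'b \<Rightarrow> 'a \<times> 'b" where
  "scaleC_prod c z = (c *\<^sub>C fst z, c *\<^sub>C snd z)"

definition cinner_prod :: "'a \<times> 'b \<Rightarrow> 'a \<times> 'b \<Rightarrow> complex" where
  "cinner_prod z w = cinner (fst z) (fst w) + cinner (snd z) (snd w)"

instance
proof
  fix r :: real and c d :: complex and x y z :: "'a \<times> 'b"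
  show "complex_of_real r *\<^sub>C x = r *\<^sub>R x"
    by (simp add: scaleC_prod_def scaleC_of_real prod_eq_iff)
  show "c *\<^sub>C (x + y) = c *\<^sub>C x + c *\<^sub>C y"
    by (simp add: scaleC_prod_def scaleC_add_right)
  show "(c + d) *\<^sub>C x = c *\<^sub>C x + d *\<^sub>C x"
    by (simp add: scaleC_prod_def scaleC_add_left)
  show "c *\<^sub>C (d *\<^sub>C x) = (c * d) *\<^sub>C x"
    by (simp add: scaleC_prod_def scaleC_scaleC)
  show "cinner (x + y) z = cinner x z + cinner y z"
    by (simp add: cinner_prod_def cinner_add_left)
  show "cinner (c *\<^sub>C x) y = c * cinner x y"
    by (simp add: cinner_prod_def scaleC_prod_def cinner_scaleC_left distrib_left)
  show "cinner x y = cnj (cinner y x)"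
    by (simp add: cinner_prod_def cinner_commute [symmetric])
  show "Re (cinner x y) = inner x y"
    by (simp add: cinner_prod_def Re_cinner inner_prod_def)
qed

end

definition csubspace :: "'a::complex_inner set \<Rightarrow> bool" where
  "csubspace D \<longleftrightarrow>
    0 \<in> D \<and> (\<forall>x\<in>D. \<forall>y\<in>D. x + y \<in> D) \<and> (\<forall>c. \<forall>x\<in>D. c *\<^sub>C x \<in> D)"

definition clinear_on :: "'a::complex_inner set \<Rightarrow> ('a \<Rightarrow> 'b::complex_inner) \<Rightarrow> bool" where
  "clinear_on D T \<longleftrightarrow> csubspace D \<and> (\<forall>x\<in>D. \<forall>y\<in>D. T (x + y) = T x + T y) \<and>
    (\<forall>c. \<forall>x\<in>D. T (c *\<^sub>C x) = c *\<^sub>C T x)"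


section \<open>Unbounded operators\<close>

text \<open>
  An operator is given by its domain \<open>D\<close> and a function \<open>T\<close>, whose values outside \<open>D\<close> are
  irrelevant. Selfadjointness says that the graph of the adjoint is the graph of the operator.
\<close>

definition selfadjoint :: "'a::complex_inner set \<Rightarrow> ('a \<Rightarrow> 'a) \<Rightarrow> bool" where
  "selfadjoint D T \<longleftrightarrow> clinear_on D T \<and> closure D = UNIV \<and>
    {(y, z). \<forall>x\<in>D. cinner (T x) y = cinner x z} = (\<lambda>x. (x, T x)) ` D"

definition strictly_positive :: "'a::complex_inner set \<Rightarrow> ('a \<Rightarrow> 'a) \<Rightarrow> bool" where
  "strictly_positive D T \<longleftrightarrow> (\<exists>c>0. \<forall>x\<in>D. c * (norm x)\<^sup>2 \<le> Re (cinner (T x) x))"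

definition resolvent_set :: "'a::complex_inner set \<Rightarrow> ('a \<Rightarrow> 'a) \<Rightarrow> complex set" where
  "resolvent_set D T = {l. bij_betw (\<lambda>x. T x - l *\<^sub>C x) D UNIV \<and>
    (\<exists>C. \<forall>x\<in>D. norm x \<le> C * norm (T x - l *\<^sub>C x))}"

definition spectrum :: "'a::complex_inner set \<Rightarrow> ('a \<Rightarrow> 'a) \<Rightarrow> complex set" where
  "spectrum D T = - resolvent_set D T"

text \<open>The spectrum of a selfadjoint operator is contained in the real axis; the following
  is the same set as a set of reals.\<close>

definition rspectrum :: "'a::complex_inner set \<Rightarrow> ('a \<Rightarrow> 'a) \<Rightarrow> real set" where
  "rspectrum D T = {s. complex_of_real s \<in> spectrum D T}"


section \<open>Spectral measures and functional calculus\<close>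

definition orth_projection :: "('a::complex_inner \<Rightarrow> 'a) \<Rightarrow> bool" where
  "orth_projection P \<longleftrightarrow> clinear_on UNIV P \<and> (\<forall>x. P (P x) = P x) \<and>
    (\<forall>x y. cinner (P x) y = cinner x (P y))"

definition projection_valued_measure ::
    "'s measure \<Rightarrow> ('s set \<Rightarrow> 'a::complex_inner \<Rightarrow> 'a) \<Rightarrow> bool" where
  "projection_valued_measure M E \<longleftrightarrow>
    (\<forall>B\<in>sets M. orth_projection (E B)) \<and> (\<forall>x. E (space M) x = x) \<and>
    (\<forall>F::nat \<Rightarrow> 's set. range F \<subseteq> sets M \<longrightarrow> disjoint_family F \<longrightarrow>
      (\<forall>x. (\<lambda>n. E (F n) x) sums E (\<Union>n. F n) x))"

text \<open>In these definitions \<open>M\<close> only serves to specify the measurable space.\<close>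

definition scalar_measure ::
    "'s measure \<Rightarrow> ('s set \<Rightarrow> 'a::complex_inner \<Rightarrow> 'a) \<Rightarrow> 'a \<Rightarrow> 's measure" where
  "scalar_measure M E x =
    measure_of (space M) (sets M) (\<lambda>B. ennreal (Re (cinner (E B x) x)))"

text \<open>
  The operator \<open>\<integral> g dE\<close> for a real function \<open>g\<close>: its domain consists of the \<open>x\<close> with \<open>g\<close> square
  integrable for \<open>\<langle>E x, x\<rangle>\<close>, and its value at \<open>x\<close> is determined by
  \<open>\<langle>(\<integral> g dE) x, z\<rangle> = \<integral> g d\<langle>E x, z\<rangle>\<close> for all \<open>z\<close> in the (dense) domain, where the complex
  measure \<open>\<langle>E x, z\<rangle>\<close> is expressed by polarization:
  \<open>\<langle>E x, z\<rangle> = (\<Sum>k<4. i^k \<langle>E (x + i^k z), x + i^k z\<rangle>) / 4\<close>.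
\<close>

definition fcalc_dom ::
    "'s measure \<Rightarrow> ('s set \<Rightarrow> 'a::complex_inner \<Rightarrow> 'a) \<Rightarrow> ('s \<Rightarrow> real) \<Rightarrow> 'a set" where
  "fcalc_dom M E g = {x. integrable (scalar_measure M E x) (\<lambda>s. (g s)\<^sup>2)}"

definition spectral_form ::
    "'s measure \<Rightarrow> ('s set \<Rightarrow> 'a::complex_inner \<Rightarrow> 'a) \<Rightarrow> ('s \<Rightarrow> real) \<Rightarrow> 'a \<Rightarrow> 'a \<Rightarrow> complex" where
  "spectral_form M E g x z =
    (\<Sum>k<4. \<i> ^ k * complex_of_real (\<integral>s. g s \<partial>scalar_measure M E (x + \<i> ^ k *\<^sub>C z))) / 4"

definition fcalc ::
    "'s measure \<Rightarrow> ('s set \<Rightarrow> 'a::complex_inner \<Rightarrow> 'a) \<Rightarrow> ('s \<Rightarrow> real) \<Rightarrow> 'a \<Rightarrow> 'a" where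
  "fcalc M E g x = (THE y. \<forall>z\<in>fcalc_dom M E g. cinner y z = spectral_form M E g x z)"

abbreviation spec_space :: "'a::complex_inner set \<Rightarrow> ('a \<Rightarrow> 'a) \<Rightarrow> real measure" where
  "spec_space D A \<equiv> restrict_space borel (rspectrum D A)"

definition is_spectral_measure_of ::
    "(real set \<Rightarrow> 'a \<Rightarrow> 'a) \<Rightarrow> 'a::complex_inner set \<Rightarrow> ('a \<Rightarrow> 'a) \<Rightarrow> bool" where
  "is_spectral_measure_of E D A \<longleftrightarrow>
    projection_valued_measure (spec_space D A) E \<and>
    fcalc_dom (spec_space D A) E (\<lambda>s. s) = D \<and>
    (\<forall>x\<in>D. fcalc (spec_space D A) E (\<lambda>s. s) x = A x)"


section \<open>The phase space and the generator\<close>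

text \<open>Throughout, \<open>E\<close> is meant to be the spectral measure of the operator \<open>A\<close> with domain \<open>D\<close>.\<close>

definition sobolev_space ::
    "'a::complex_inner set \<Rightarrow> ('a \<Rightarrow> 'a) \<Rightarrow> (real set \<Rightarrow> 'a \<Rightarrow> 'a) \<Rightarrow> real \<Rightarrow> 'a set" where
  "sobolev_space D A E r = fcalc_dom (spec_space D A) E (\<lambda>s. s powr (r / 2))"

definition sobolev_norm ::
    "'a::complex_inner set \<Rightarrow> ('a \<Rightarrow> 'a) \<Rightarrow> (real set \<Rightarrow> 'a \<Rightarrow> 'a) \<Rightarrow> real \<Rightarrow> 'a \<Rightarrow> real" where
  "sobolev_norm D A E r u = norm (fcalc (spec_space D A) E (\<lambda>s. s powr (r / 2)) u)"

definition phase_space ::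
    "'a::complex_inner set \<Rightarrow> ('a \<Rightarrow> 'a) \<Rightarrow> (real set \<Rightarrow> 'a \<Rightarrow> 'a) \<Rightarrow> ('a \<times> 'a) set" where
  "phase_space D A E = sobolev_space D A E 1 \<times> UNIV"

definition phase_norm ::
    "'a::complex_inner set \<Rightarrow> ('a \<Rightarrow> 'a) \<Rightarrow> (real set \<Rightarrow> 'a \<Rightarrow> 'a) \<Rightarrow> 'a \<times> 'a \<Rightarrow> real" where
  "phase_norm D A E = (\<lambda>(u, v). sqrt ((sobolev_norm D A E 1 u)\<^sup>2 + (norm v)\<^sup>2))"

text \<open>\<open>is_weak_sum D A E f u v h\<close> expresses \<open>A u + f(A) v = h\<close> in the sense of duality.\<close>

definition is_weak_sum ::
    "'a::complex_inner set \<Rightarrow> ('a \<Rightarrow> 'a) \<Rightarrow> (real set \<Rightarrow> 'a \<Rightarrow> 'a) \<Rightarrow> (real \<Rightarrow> real) \<Rightarrow>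
      'a \<Rightarrow> 'a \<Rightarrow> 'a \<Rightarrow> bool" where
  "is_weak_sum D A E f u v h \<longleftrightarrow> (\<forall>w \<in> D \<inter> fcalc_dom (spec_space D A) E f.
    cinner (A w) u + cinner (fcalc (spec_space D A) E f w) v = cinner w h)"

definition wave_dom ::
    "'a::complex_inner set \<Rightarrow> ('a \<Rightarrow> 'a) \<Rightarrow> (real set \<Rightarrow> 'a \<Rightarrow> 'a) \<Rightarrow> (real \<Rightarrow> real) \<Rightarrow>
      ('a \<times> 'a) set" where
  "wave_dom D A E f = {(u, v) \<in> phase_space D A E.
    v \<in> sobolev_space D A E 1 \<and> (\<exists>h. is_weak_sum D A E f u v h)}"

definition wave_op ::
    "'a::complex_inner set \<Rightarrow> ('a \<Rightarrow> 'a) \<Rightarrow> (real set \<Rightarrow> 'a \<Rightarrow> 'a) \<Rightarrow> (real \<Rightarrow> real) \<Rightarrow>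
      'a \<times> 'a \<Rightarrow> 'a \<times> 'a" where
  "wave_op D A E f = (\<lambda>(u, v). (v, - (THE h. is_weak_sum D A E f u v h)))"


section \<open>Semigroups\<close>

text \<open>
  The space is a complex subspace \<open>X\<close> of the ambient type, with a norm \<open>N\<close> of its own. Below, \<open>X\<close>
  is the phase space, whose norm is not the one of the product type.
\<close>

definition contraction_semigroup ::
    "'b::complex_inner set \<Rightarrow> ('b \<Rightarrow> real) \<Rightarrow> (real \<Rightarrow> 'b \<Rightarrow> 'b) \<Rightarrow> bool" where
  "contraction_semigroup X N S \<longleftrightarrow>
    (\<forall>t\<ge>0. S t ` X \<subseteq> X \<and> clinear_on X (S t)) \<and>
    (\<forall>z\<in>X. S 0 z = z) \<and>
    (\<forall>s\<ge>0. \<forall>t\<ge>0. \<forall>z\<in>X. S (s + t) z = S s (S t z)) \<and>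
    (\<forall>z\<in>X. ((\<lambda>t. N (S t z - z)) \<longlongrightarrow> 0) (at_right 0)) \<and>
    (\<forall>t\<ge>0. \<forall>z\<in>X. N (S t z) \<le> N z)"

definition generator_graph ::
    "'b::complex_inner set \<Rightarrow> ('b \<Rightarrow> real) \<Rightarrow> (real \<Rightarrow> 'b \<Rightarrow> 'b) \<Rightarrow> ('b \<times> 'b) set" where
  "generator_graph X N S = {(z, w). z \<in> X \<and> w \<in> X \<and>
    ((\<lambda>t. N ((S t z - z) /\<^sub>R t - w)) \<longlongrightarrow> 0) (at_right 0)}"

definition generated_by ::
    "'b::complex_inner set \<Rightarrow> ('b \<Rightarrow> real) \<Rightarrow> (real \<Rightarrow> 'b \<Rightarrow> 'b) \<Rightarrow> 'b set \<Rightarrow> ('b \<Rightarrow> 'b) \<Rightarrow> bool" where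
  "generated_by X N S D G \<longleftrightarrow> generator_graph X N S = (\<lambda>z. (z, G z)) ` D"

definition semiuniformly_stable ::
    "('b \<Rightarrow> real) \<Rightarrow> (real \<Rightarrow> 'b \<Rightarrow> 'b) \<Rightarrow> 'b set \<Rightarrow> ('b \<Rightarrow> 'b) \<Rightarrow> bool" where
  "semiuniformly_stable N S D G \<longleftrightarrow>
    (\<exists>\<psi>::real \<Rightarrow> real. (\<forall>t\<ge>0. 0 \<le> \<psi> t) \<and> (\<psi> \<longlongrightarrow> 0) at_top \<and>
      (\<forall>z\<in>D. \<forall>t\<ge>0. N (S t z) \<le> \<psi> t * N (G z)))"

end

theory Submission
  imports Defs
begin

text \<open>
  On the range of a spectral projection \<open>E B\<close> with \<open>B\<close> bounded and \<open>f\<close> bounded on \<open>B\<close>, the wave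
  equation \<open>u'' + f(A) u' + A u = 0\<close> has bounded coefficients, and its trajectories stay in this range
  because the complementary component solves the same dissipative equation with initial value zero.

  If \<open>f\<close> has no zero and \<open>f s \<le> C s\<close>, split such data at the level \<open>f = h\<close>. Where \<open>f \<ge> h\<close>, a Lyapunov
  function gives uniform decay of the energy. Where \<open>f < h\<close>, the spectral parameter is at least \<open>r\<close>,
  by compactness of \<open>\<sigma>(A) \<inter> [0, r]\<close> when \<open>h\<close> is small, and there the inverse of the generator has
  norm \<open>O(1 / sqrt r)\<close>, so contractivity suffices. Density of the truncated data finishes the proof.

  Conversely, approximate eigenvectors \<open>x\<close> of \<open>A\<close> at \<open>s\<close> provide test data. If \<open>f s = 0\<close>, the
  energy of the trajectory through \<open>(x, 0)\<close> is almost conserved, while the generator is bounded on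
  these data uniformly in the approximation. The data \<open>(- (f s / s) x, x)\<close> at time \<open>0\<close> show that
  \<open>f s / s\<close> is at most a constant multiple of the norm of the inverse of the generator.
\<close>

section \<open>Complex inner products\<close>

text \<open>For bounded \<open>f s / s\<close> the inverse of the generator sends (p, q) to (-
  A^{-1} (q + f(A) p), p). Its block f(A) A^{-1}, acting on H^1, has norm sup f s / s, so the second
  condition expresses boundedness of this inverse, which is the stability estimate at time 0.

  Decay of the energy need not be uniform in the data, since \<open>f s\<close> may tend to 0 as
  \<open>s\<close> grows. Hence the splitting by the size of \<open>f\<close> and not of
  \<open>s\<close>: where \<open>f\<close> is small, frequencies are high and the norm of the
  generator pays; where \<open>f\<close> is large it may be unbounded, which the Lyapunov function
  tolerates as long as \<open>f s \<le> C * s\<close>.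

  Two obstacles shape the formal proof. \<open>fcalc\<close> is a definite description through
  polarized scalar measures, so linearity, symmetry and commutation with \<open>E\<close> are
  obtained as limits along simple functions. The semigroup is given only by contractivity and the
  graph of its generator, so there is no formula for trajectories and differentiation in time is
  one-sided.\<close>

lemma scaleC_scaleR: "c *\<^sub>C (r *\<^sub>R x) = r *\<^sub>R (c *\<^sub>C (x::'a::complex_inner))"
  by (metis mult.commute scaleC_of_real scaleC_scaleC)

lemma scaleC_zero_right: "c *\<^sub>C (0::'a::complex_inner) = 0"
  using scaleC_scaleR [of c 0 0] by simp

lemma scaleC_minus_right: "c *\<^sub>C (- x) = - (c *\<^sub>C (x::'a::complex_inner))"
  using scaleC_scaleR [of c "-1" x] by simp

lemma cinner_add_right: "cinner x (y + z) = cinner x y + cinner x (z::'a::complex_inner)"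
  by (metis cinner_add_left cinner_commute complex_cnj_add)

lemma cinner_scaleC_right: "cinner x (c *\<^sub>C y) = cnj c * cinner x (y::'a::complex_inner)"
  by (metis cinner_commute cinner_scaleC_left complex_cnj_mult)

lemma cinner_scaleR_left: "cinner (r *\<^sub>R x) (y::'a::complex_inner) = of_real r * cinner x y"
  by (metis cinner_scaleC_left scaleC_of_real)

lemma cinner_scaleR_right: "cinner x (r *\<^sub>R (y::'a::complex_inner)) = of_real r * cinner x y"
  by (metis cinner_scaleC_right scaleC_of_real complex_cnj_complex_of_real)

lemma cinner_zero_left [simp]: "cinner 0 (y::'a::complex_inner) = 0"
  using cinner_scaleR_left [of 0 0 y] by simp

lemma cinner_zero_right [simp]: "cinner (y::'a::complex_inner) 0 = 0"
  using cinner_scaleR_right [of y 0 0] by simp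

lemma cinner_minus_left: "cinner (- x) (y::'a::complex_inner) = - cinner x y"
  using cinner_scaleR_left [of "-1" x y] by simp

lemma cinner_diff_left: "cinner (x - y) (z::'a::complex_inner) = cinner x z - cinner y z"
  using cinner_add_left [of x "- y" z] by (simp add: cinner_minus_left)

lemma cinner_sum_left: "cinner (sum g I) (y::'a::complex_inner) = (\<Sum>i\<in>I. cinner (g i) y)"
  by (induction I rule: infinite_finite_induct) (auto simp: cinner_add_left)

lemma cinner_sum_right: "cinner y (sum g I) = (\<Sum>i\<in>I. cinner (y::'a::complex_inner) (g i))"
  by (induction I rule: infinite_finite_induct) (auto simp: cinner_add_right)

text \<open>Reduces continuity of the complex inner product to that of the real one.\<close>

lemma cinner_eq_Complex: "cinner x y = Complex (inner x y) (inner x (\<i> *\<^sub>C (y::'a::complex_inner)))"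
proof -
  have "inner x (\<i> *\<^sub>C y) = Im (cinner x y)"
    by (simp flip: Re_cinner add: cinner_scaleC_right)
  then show ?thesis by (simp add: complex_eq_iff Re_cinner)
qed

lemma tendsto_cinner_left:
  assumes "(g \<longlongrightarrow> x) F"
  shows "((\<lambda>n. cinner (g n) (y::'a::complex_inner)) \<longlongrightarrow> cinner x y) F"
  unfolding cinner_eq_Complex by (intro tendsto_intros assms)

lemma tendsto_cinner_right:
  assumes "(g \<longlongrightarrow> x) F"
  shows "((\<lambda>n. cinner (y::'a::complex_inner) (g n)) \<longlongrightarrow> cinner y x) F"
  using tendsto_cnj [OF tendsto_cinner_left [OF assms, of y]] by (simp flip: cinner_commute)

lemma eq_of_cinner_dense:
  fixes y z :: "'a::complex_inner"
  assumes "closure V = UNIV" and "\<And>x. x \<in> V \<Longrightarrow> cinner x y = cinner x z"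
  shows "y = z"
proof -
  have "y - z \<in> closure V" using assms(1) by simp
  then obtain X where X: "\<And>n. X n \<in> V" "X \<longlonglongrightarrow> y - z"
    unfolding closure_sequential by blast
  have "inner (X n) (y - z) = 0" for n
    using arg_cong [where f = Re, OF assms(2) [OF X(1) [of n]]]
    by (simp add: Re_cinner inner_diff_right)
  moreover have "(\<lambda>n. inner (X n) (y - z)) \<longlonglongrightarrow> inner (y - z) (y - z)"
    by (intro tendsto_intros X)
  ultimately have "inner (y - z) (y - z) = 0" by (simp add: LIMSEQ_const_iff)
  then show ?thesis by simp
qed

lemma clinear_onD:
  assumes "clinear_on V T"
  shows "0 \<in> V"
    and "x \<in> V \<Longrightarrow> y \<in> V \<Longrightarrow> x + y \<in> V"
    and "x \<in> V \<Longrightarrow> c *\<^sub>C x \<in> V"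
    and "x \<in> V \<Longrightarrow> r *\<^sub>R x \<in> V"
    and "x \<in> V \<Longrightarrow> - x \<in> V"
    and "x \<in> V \<Longrightarrow> y \<in> V \<Longrightarrow> x - y \<in> V"
    and "x \<in> V \<Longrightarrow> y \<in> V \<Longrightarrow> T (x + y) = T x + T y"
    and "x \<in> V \<Longrightarrow> T (c *\<^sub>C x) = c *\<^sub>C T x"
    and "x \<in> V \<Longrightarrow> T (r *\<^sub>R x) = r *\<^sub>R T x"
    and "x \<in> V \<Longrightarrow> T (- x) = - T x"
    and "x \<in> V \<Longrightarrow> y \<in> V \<Longrightarrow> T (x - y) = T x - T y"
    and "T 0 = 0"
proof -
  note * = assms [unfolded clinear_on_def csubspace_def]
  have sub: "\<And>r x. x \<in> V \<Longrightarrow> r *\<^sub>R x \<in> V" "\<And>r x. x \<in> V \<Longrightarrow> T (r *\<^sub>R x) = r *\<^sub>R T x"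
    using * by (metis scaleC_of_real)+
  have neg: "\<And>x. x \<in> V \<Longrightarrow> - x \<in> V" "\<And>x. x \<in> V \<Longrightarrow> T (- x) = - T x"
    using sub [of _ "-1"] by auto
  show "0 \<in> V" using * by blast
  then show "T 0 = 0" using sub(2) [of 0 0] by simp
  show "x \<in> V \<Longrightarrow> y \<in> V \<Longrightarrow> x + y \<in> V" "x \<in> V \<Longrightarrow> c *\<^sub>C x \<in> V"
    "x \<in> V \<Longrightarrow> y \<in> V \<Longrightarrow> T (x + y) = T x + T y" "x \<in> V \<Longrightarrow> T (c *\<^sub>C x) = c *\<^sub>C T x"
    using * by blast+
  show "x \<in> V \<Longrightarrow> r *\<^sub>R x \<in> V" "x \<in> V \<Longrightarrow> T (r *\<^sub>R x) = r *\<^sub>R T x"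
    "x \<in> V \<Longrightarrow> - x \<in> V" "x \<in> V \<Longrightarrow> T (- x) = - T x" using sub neg by auto
  show "x \<in> V \<Longrightarrow> y \<in> V \<Longrightarrow> x - y \<in> V"
    using * neg by (metis diff_conv_add_uminus)
  show "x \<in> V \<Longrightarrow> y \<in> V \<Longrightarrow> T (x - y) = T x - T y"
    using * neg by (metis diff_conv_add_uminus)
qed

text \<open>Shaped to match \<open>spectral_form\<close>. After expansion only the coefficient of
  \<open>cinner (T x) z\<close> is independent of \<open>k\<close>; the others are
  \<open>\<i> ^ k\<close> or \<open>(-1) ^ k\<close> and sum to zero over
  \<open>k < 4\<close>.\<close>

lemma cinner_polarization:
  fixes x z :: "'a::complex_inner"
  assumes T: "clinear_on UNIV T"
  shows "cinner (T x) z =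
    (\<Sum>k<4. \<i> ^ k * cinner (T (x + \<i> ^ k *\<^sub>C z)) (x + \<i> ^ k *\<^sub>C z)) / 4"
proof -
  note T = clinear_onD [OF T]
  have "\<i> ^ k * cinner (T (x + \<i> ^ k *\<^sub>C z)) (x + \<i> ^ k *\<^sub>C z) =
    \<i> ^ k * cinner (T x) x + (\<i> * \<i>) ^ k * cinner (T z) x + cinner (T x) z + \<i> ^ k * cinner (T z) z" for k
  proof -
    have 1: "\<i> ^ k * cnj (\<i> ^ k) = 1"
      by (simp flip: power_mult_distrib)
    have "\<i> ^ k * cinner (T (x + \<i> ^ k *\<^sub>C z)) (x + \<i> ^ k *\<^sub>C z) =
       \<i> ^ k * cinner (T x) x + (\<i> ^ k * \<i> ^ k) * cinner (T z) x + (\<i> ^ k * cnj (\<i> ^ k)) * cinner (T x) z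
      + \<i> ^ k * (\<i> ^ k * cnj (\<i> ^ k)) * cinner (T z) z"
      by (simp add: T cinner_add_left cinner_add_right cinner_scaleC_left cinner_scaleC_right
          algebra_simps del: complex_cnj_power)
    then show ?thesis unfolding 1 by (simp flip: power_mult_distrib)
  qed
  then show ?thesis
    by (simp add: numeral_eq_Suc algebra_simps)
qed

lemma scaleC_sum_right: "c *\<^sub>C (sum g I) = (\<Sum>i\<in>I. c *\<^sub>C (g i::'a::complex_inner))"
  by (induction I rule: infinite_finite_induct) (auto simp: scaleC_add_right scaleC_zero_right)

lemma norm_scaleC: "norm (c *\<^sub>C (x::'a::complex_inner)) = cmod c * norm x"
proof -
  have nn: "cinner x x = complex_of_real ((norm x)\<^sup>2)"
    by (metis Re_cinner cinner_commute complex_cnj_cancel_iff complex_is_Real_iff Reals_cnj_iff of_real_Re power2_norm_eq_inner)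
  have "(norm (c *\<^sub>C x))\<^sup>2 = Re (c * cnj c * cinner x x)"
    by (simp add: power2_norm_eq_inner cinner_scaleC_left cinner_scaleC_right mult_ac flip: Re_cinner)
  also have "\<dots> = (cmod c * norm x)\<^sup>2"
    unfolding complex_norm_square [symmetric] nn by (simp add: power_mult_distrib flip: of_real_mult)
  finally show ?thesis by simp
qed

lemma bounded_linear_scaleC_right: "bounded_linear (\<lambda>x. c *\<^sub>C (x::'a::complex_inner))"
  by (rule bounded_linear_intro [of _ "cmod c"])
    (auto simp: scaleC_add_right scaleC_scaleR norm_scaleC mult.commute)

section \<open>Closed subspaces of a Hilbert space\<close>

text \<open>The projection theorem in contrapositive form: a point \<open>y\<close> outside
  \<open>V\<close> has a nearest point \<open>q\<close> in \<open>V\<close>, and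
  \<open>y - q\<close> is a nonzero vector orthogonal to \<open>V\<close>.\<close>

lemma closed_subspace_eq_UNIV:
  fixes V :: "'a::{real_inner, complete_space} set"
  assumes V: "subspace V" "closed V"
    and orth: "\<And>z. (\<And>w. w \<in> V \<Longrightarrow> inner w z = 0) \<Longrightarrow> z = 0"
  shows "V = UNIV"
proof (rule ccontr)
  assume "V \<noteq> UNIV"
  then obtain y where y: "y \<notin> V" by auto
  define d where "d = infdist y V"
  have ne: "V \<noteq> {}" using subspace_0 [OF V(1)] by auto
  have d_le: "d \<le> norm (y - w)" if "w \<in> V" for w
    using infdist_le [OF that, of y] by (simp add: d_def dist_norm)
  have d0: "d \<ge> 0" by (simp add: d_def infdist_nonneg)
  have "\<exists>w\<in>V. norm (y - w) < d + 1 / Suc n" for n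
  proof (rule ccontr)
    assume "\<not> ?thesis"
    then have "d + 1 / Suc n \<le> infdist y V"
      unfolding infdist_notempty [OF ne]
      by (intro cINF_greatest ne) (auto simp: dist_norm not_less)
    then show False by (simp add: d_def)
  qed
  then obtain p where p: "\<And>n. p n \<in> V" "\<And>n. norm (y - p n) < d + 1 / Suc n" by metis
  have lim: "(\<lambda>n. norm (y - p n)) \<longlonglongrightarrow> d"
  proof (rule tendsto_sandwich [of "\<lambda>_. d" _ _ "\<lambda>n. d + 1 / Suc n"])
    show "(\<lambda>n. d + 1 / Suc n) \<longlonglongrightarrow> d"
      using tendsto_add [OF tendsto_const LIMSEQ_inverse_real_of_nat, of d]
      by (simp add: inverse_eq_divide)
    show "\<forall>\<^sub>F n in sequentially. d \<le> norm (y - p n)"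
      by (intro always_eventually allI d_le p)
    show "\<forall>\<^sub>F n in sequentially. norm (y - p n) \<le> d + 1 / Suc n"
      by (intro always_eventually allI less_imp_le p(2))
  qed (rule tendsto_const)
  \<comment> \<open>The parallelogram law; the midpoint of \<open>p m\<close> and \<open>p n\<close>
    lies in \<open>V\<close>, so its distance from \<open>y\<close> is at least \<open>d\<close>.
    This makes the minimizing sequence Cauchy.\<close>
  have par: "(norm (p m - p n))\<^sup>2 \<le> 2 * (norm (y - p m))\<^sup>2 + 2 * (norm (y - p n))\<^sup>2 - 4 * d\<^sup>2" for m n
  proof -
    have "(1/2) *\<^sub>R (p m + p n) \<in> V" by (intro subspace_scale subspace_add V p)
    from d_le [OF this] have "d\<^sup>2 \<le> (norm (y - (1/2) *\<^sub>R (p m + p n)))\<^sup>2"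
      using d0 by (intro power_mono) auto
    moreover have "(norm (p m - p n))\<^sup>2 =
      2 * (norm (y - p m))\<^sup>2 + 2 * (norm (y - p n))\<^sup>2 - 4 * (norm (y - (1/2) *\<^sub>R (p m + p n)))\<^sup>2"
      by (simp add: power2_norm_eq_inner inner_diff_left inner_diff_right inner_add_left
          inner_add_right inner_commute algebra_simps)
    ultimately show ?thesis by linarith
  qed
  have "Cauchy p"
  proof (rule metric_CauchyI)
    fix e :: real assume e: "e > 0"
    have "(\<lambda>n. (norm (y - p n))\<^sup>2) \<longlonglongrightarrow> d\<^sup>2" by (intro tendsto_intros lim)
    then have "\<forall>\<^sub>F n in sequentially. (norm (y - p n))\<^sup>2 < d\<^sup>2 + e\<^sup>2 / 4"
      using e by (intro order_tendstoD) auto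
    then obtain N where N: "\<And>n. n \<ge> N \<Longrightarrow> (norm (y - p n))\<^sup>2 < d\<^sup>2 + e\<^sup>2 / 4"
      by (auto simp: eventually_sequentially)
    have "dist (p m) (p n) < e" if "m \<ge> N" "n \<ge> N" for m n
    proof -
      have "(norm (p m - p n))\<^sup>2 < e\<^sup>2" using par [of m n] N [OF that(1)] N [OF that(2)] by linarith
      then show ?thesis using e by (simp add: dist_norm power2_less_imp_less)
    qed
    then show "\<exists>M. \<forall>m\<ge>M. \<forall>n\<ge>M. dist (p m) (p n) < e" by blast
  qed
  then obtain q where q: "p \<longlonglongrightarrow> q" using Cauchy_convergent convergent_def by blast
  have qV: "q \<in> V" using closed_sequentially [OF V(2)] p(1) q by blast
  have "(\<lambda>n. norm (y - p n)) \<longlonglongrightarrow> norm (y - q)" by (intro tendsto_intros q)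
  then have nq: "norm (y - q) = d" using lim LIMSEQ_unique by blast
  have "inner w (y - q) = 0" if w: "w \<in> V" for w
  proof (cases "w = 0")
    case False
    \<comment> \<open>The minimizer of the distance from \<open>y\<close> along the line
      \<open>q + r *\<^sub>R w\<close>.\<close>
    define r where "r = inner w (y - q) / inner w w"
    have "q + r *\<^sub>R w \<in> V" by (intro subspace_add subspace_scale V qV w)
    from d_le [OF this] have "d\<^sup>2 \<le> (norm (y - (q + r *\<^sub>R w)))\<^sup>2"
      using d0 by (intro power_mono) auto
    also have "\<dots> = (norm (y - q))\<^sup>2 - 2 * r * inner w (y - q) + r\<^sup>2 * inner w w"
      unfolding power2_norm_eq_inner power2_eq_square [of r]
      by (simp add: inner_diff_left inner_diff_right inner_add_left
          inner_add_right inner_commute algebra_simps)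
    also have "\<dots> = d\<^sup>2 - (inner w (y - q))\<^sup>2 / inner w w"
      using False by (simp add: nq r_def field_simps power2_eq_square)
    finally have "(inner w (y - q))\<^sup>2 / inner w w \<le> 0" by simp
    then show ?thesis using False
      by (simp add: divide_le_0_iff zero_less_power2 not_le flip: inner_gt_zero_iff)
  qed auto
  from orth [OF this] qV y show False by simp
qed

section \<open>Selfadjoint operators\<close>

lemma selfadjointD:
  assumes "selfadjoint D A"
  shows "clinear_on D A" and "closure D = UNIV"
    and "\<And>x y. x \<in> D \<Longrightarrow> y \<in> D \<Longrightarrow> cinner (A x) y = cinner x (A y)"
    and "\<And>y z. (\<And>x. x \<in> D \<Longrightarrow> cinner (A x) y = cinner x z) \<Longrightarrow> y \<in> D \<and> A y = z"
proof -
  note * = assms [unfolded selfadjoint_def]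
  show "clinear_on D A" "closure D = UNIV" using * by auto
  have eq: "(y, z) \<in> (\<lambda>x. (x, A x)) ` D \<longleftrightarrow> (\<forall>x\<in>D. cinner (A x) y = cinner x z)" for y z
    using * by blast
  show "cinner (A x) y = cinner x (A y)" if "x \<in> D" "y \<in> D" for x y
    using eq [of y "A y"] that by blast
  show "y \<in> D \<and> A y = z" if "\<And>x. x \<in> D \<Longrightarrow> cinner (A x) y = cinner x z" for y z
    using eq [of y z] that by auto
qed

text \<open>The lower bound gives injectivity and, as \<open>A\<close> is closed, a closed range. A
  vector orthogonal to the range satisfies \<open>A z = s *\<^sub>R z\<close> by selfadjointness,
  and the lower bound forces it to vanish.\<close>

lemma not_in_rspectrum:
  fixes A :: "'a::chilbert_space \<Rightarrow> 'a"
  assumes sa: "selfadjoint D A" and e: "e > 0"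
    and below: "\<And>x. x \<in> D \<Longrightarrow> e * norm x \<le> norm (A x - s *\<^sub>R x)"
  shows "s \<notin> rspectrum D A"
proof -
  note sa' = selfadjointD [OF sa]
  note lin = clinear_onD [OF sa'(1)]
  let ?T = "\<lambda>x. A x - s *\<^sub>R x"
  have Tdiff: "?T (x - y) = ?T x - ?T y" if "x \<in> D" "y \<in> D" for x y
    using that by (simp add: lin scaleR_diff_right)
  have inj: "inj_on ?T D"
  proof (rule inj_onI)
    fix x y assume xy: "x \<in> D" "y \<in> D" "?T x = ?T y"
    then have "e * norm (x - y) \<le> 0" using below [of "x - y"] lin(6) Tdiff by simp
    then show "x = y" using e by (simp add: mult_le_0_iff)
  qed
  have sub: "subspace (?T ` D)"
  proof (rule subspaceI)
    show "0 \<in> ?T ` D" using lin(1,12) by (intro image_eqI [of _ _ 0]) auto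
    fix a b r assume "a \<in> ?T ` D"
    then obtain x where x: "x \<in> D" "a = ?T x" by blast
    show "r *\<^sub>R a \<in> ?T ` D"
      by (rule image_eqI [of _ _ "r *\<^sub>R x"]) (use x lin in \<open>auto simp: scaleR_diff_right\<close>)
    assume "b \<in> ?T ` D"
    then obtain y where y: "y \<in> D" "b = ?T y" by blast
    show "a + b \<in> ?T ` D"
      by (rule image_eqI [of _ _ "x + y"]) (use x y lin in \<open>auto simp: scaleR_add_right\<close>)
  qed
  have clo: "closed (?T ` D)"
    unfolding closed_sequential_limits
  proof (intro allI impI, elim conjE)
    fix Y l assume "\<forall>n. Y n \<in> ?T ` D" and l: "Y \<longlonglongrightarrow> l"
    then have "\<forall>n. \<exists>x. x \<in> D \<and> Y n = ?T x" by blast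
    from choice [OF this] obtain X where X: "\<And>n. X n \<in> D" "\<And>n. Y n = ?T (X n)" by blast
    have "Cauchy X"
    proof (rule metric_CauchyI)
      fix d :: real assume d: "d > 0"
      then have "e * d > 0" using e by simp
      then obtain N where N: "\<And>m n. m \<ge> N \<Longrightarrow> n \<ge> N \<Longrightarrow> dist (Y m) (Y n) < e * d"
        using metric_CauchyD [OF LIMSEQ_imp_Cauchy [OF l]] by blast
      have "dist (X m) (X n) < d" if "m \<ge> N" "n \<ge> N" for m n
      proof -
        have "e * norm (X m - X n) \<le> norm (Y m - Y n)"
          using below [of "X m - X n"] X Tdiff lin(6) by simp
        also have "\<dots> < e * d" using N [OF that] by (simp add: dist_norm)
        finally show ?thesis using e by (simp add: dist_norm)
      qed
      then show "\<exists>M. \<forall>m\<ge>M. \<forall>n\<ge>M. dist (X m) (X n) < d" by blast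
    qed
    then obtain x where x: "X \<longlonglongrightarrow> x" using Cauchy_convergent convergent_def by blast
    have AX: "(\<lambda>n. A (X n)) \<longlonglongrightarrow> l + s *\<^sub>R x"
      using tendsto_add [OF l tendsto_scaleR [OF tendsto_const x, of s]] by (simp add: X(2))
    \<comment> \<open>Closedness of \<open>A\<close>: its graph is that of an adjoint, so it
      suffices to pass to the limit in the pairing with each \<open>w\<close>.\<close>
    have "x \<in> D \<and> A x = l + s *\<^sub>R x"
    proof (rule sa'(4))
      fix w assume w: "w \<in> D"
      have "(\<lambda>n. cinner (A w) (X n)) \<longlonglongrightarrow> cinner w (l + s *\<^sub>R x)"
        using tendsto_cinner_right [OF AX, of w] by (simp add: sa'(3) w X(1))
      then show "cinner (A w) x = cinner w (l + s *\<^sub>R x)"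
        using tendsto_cinner_right [OF x, of "A w"] LIMSEQ_unique by blast
    qed
    then show "l \<in> ?T ` D" by (intro image_eqI [of _ _ x]) auto
  qed
  have "?T ` D = UNIV"
  proof (rule closed_subspace_eq_UNIV [OF sub clo])
    fix z assume orth: "\<And>w. w \<in> ?T ` D \<Longrightarrow> inner w z = 0"
    have "z \<in> D \<and> A z = s *\<^sub>R z"
    proof (rule sa'(4))
      fix w assume w: "w \<in> D"
      have r: "inner (?T x) z = 0" if "x \<in> D" for x using orth that by blast
      \<comment> \<open>Orthogonality is only real so far; testing with
        \<open>\<i> *\<^sub>C w\<close> supplies the imaginary part.\<close>
      have "\<i> *\<^sub>C ?T w = ?T (\<i> *\<^sub>C w)"
        using w lin(8) [of w "\<i>"] scaleC_add_right [of \<i> "A w" "- (s *\<^sub>R w)"]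
        by (simp add: scaleC_scaleR scaleC_minus_right)
      then have "Re (cinner (\<i> *\<^sub>C ?T w) z) = 0"
        using r [OF lin(3) [OF w, of \<i>]] by (simp add: Re_cinner)
      then have "cinner (?T w) z = 0"
        using r [OF w] by (simp add: cinner_scaleC_left complex_eq_iff Re_cinner)
      then show "cinner (A w) z = cinner w (s *\<^sub>R z)"
        by (simp add: cinner_diff_left cinner_scaleR_left cinner_scaleR_right)
    qed
    then have "e * norm z \<le> 0" using below [of z] by simp
    then show "z = 0" using e by (simp add: mult_le_0_iff)
  qed
  then have bij: "bij_betw ?T D UNIV" using inj by (simp add: bij_betw_def)
  have "norm x \<le> (1 / e) * norm (?T x)" if "x \<in> D" for x
    using below [OF that] e by (simp add: field_simps)
  with bij have "complex_of_real s \<in> resolvent_set D A"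
    unfolding resolvent_set_def mem_Collect_eq scaleC_of_real by blast
  then show ?thesis by (simp add: rspectrum_def spectrum_def)
qed

lemma rspectrum_ge:
  fixes A :: "'a::chilbert_space \<Rightarrow> 'a"
  assumes sa: "selfadjoint D A" 
    and pos: "\<And>x. x \<in> D \<Longrightarrow> c * (norm x)\<^sup>2 \<le> Re (cinner (A x) x)"
    and s: "s \<in> rspectrum D A"
  shows "c \<le> s"
proof (rule ccontr)
  assume "\<not> c \<le> s"
  then have cs: "c - s > 0" by simp
  have "(c - s) * norm x \<le> norm (A x - s *\<^sub>R x)" if x: "x \<in> D" for x
  proof (cases "x = 0")
    case False
    have "(c - s) * (norm x)\<^sup>2 \<le> inner (A x - s *\<^sub>R x) x"
      using pos [OF x] by (simp add: inner_diff_left Re_cinner power2_norm_eq_inner algebra_simps)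
    also have "\<dots> \<le> norm (A x - s *\<^sub>R x) * norm x" by (rule norm_cauchy_schwarz)
    finally show ?thesis using False by (simp add: power2_eq_square)
  qed auto
  from not_in_rspectrum [OF sa cs this] s show False by blast
qed

text \<open>Being bounded below is stable under small shifts of the spectral parameter, so the
  resolvent points on the real line form an open set.\<close>

lemma closed_rspectrum:
  fixes A :: "'a::chilbert_space \<Rightarrow> 'a"
  assumes sa: "selfadjoint D A"
  shows "closed (rspectrum D A)"
proof -
  have "\<exists>e>0. ball s e \<subseteq> - rspectrum D A" if "s \<in> - rspectrum D A" for s
  proof -
    from that have "complex_of_real s \<in> resolvent_set D A" by (simp add: rspectrum_def spectrum_def)
    then obtain C where C: "\<And>x. x \<in> D \<Longrightarrow> norm x \<le> C * norm (A x - s *\<^sub>R x)"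
      unfolding resolvent_set_def mem_Collect_eq scaleC_of_real by blast
    \<comment> \<open>The lower bound at \<open>s\<close> is at least \<open>2 * e\<close>, and a
      shift by less than \<open>e\<close> costs at most \<open>e\<close> of it; the summand 1 keeps
      the denominator positive.\<close>
    define e where "e = 1 / (2 * (\<bar>C\<bar> + 1))"
    have e: "e > 0" by (simp add: e_def)
    have "r \<notin> rspectrum D A" if r: "r \<in> ball s e" for r
    proof (rule not_in_rspectrum [OF sa e])
      fix x assume x: "x \<in> D"
      have "norm x \<le> (\<bar>C\<bar> + 1) * norm (A x - s *\<^sub>R x)"
        using C [OF x] by (rule order_trans) (intro mult_right_mono, auto)
      then have "2 * e * norm x \<le> norm (A x - s *\<^sub>R x)" by (simp add: e_def field_simps)
      also have "\<dots> \<le> norm (A x - r *\<^sub>R x) + norm ((r - s) *\<^sub>R x)"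
        using norm_triangle_ineq [of "A x - r *\<^sub>R x" "(r - s) *\<^sub>R x"] by (simp add: scaleR_diff_left)
      also have "norm ((r - s) *\<^sub>R x) \<le> e * norm x"
        using r by (auto simp: dist_real_def intro!: mult_right_mono)
      finally show "e * norm x \<le> norm (A x - r *\<^sub>R x)" by simp
    qed
    then show ?thesis using e by blast
  qed
  then show ?thesis by (simp add: closed_def open_contains_ball)
qed

section \<open>Functional calculus of a projection-valued measure\<close>

locale pvm =
  fixes M :: "'s measure" and E :: "'s set \<Rightarrow> 'a::chilbert_space \<Rightarrow> 'a"
  assumes pvm: "projection_valued_measure M E"
begin

abbreviation \<mu> :: "'a \<Rightarrow> 's measure" where "\<mu> \<equiv> scalar_measure M E"
abbreviation dom :: "('s \<Rightarrow> real) \<Rightarrow> 'a set" where "dom \<equiv> fcalc_dom M E"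

section \<open>Algebra of the spectral projections\<close>

lemma E_lin: "B \<in> sets M \<Longrightarrow> clinear_on UNIV (E B)"
  and E_idem: "B \<in> sets M \<Longrightarrow> E B (E B x) = E B x"
  and E_sym: "B \<in> sets M \<Longrightarrow> cinner (E B x) y = cinner x (E B y)"
  and E_space: "E (space M) x = x"
  and E_sums: "range F \<subseteq> sets M \<Longrightarrow> disjoint_family F \<Longrightarrow> (\<lambda>n. E (F n) x) sums E (\<Union>n. F n) x"
  using pvm unfolding projection_valued_measure_def orth_projection_def by auto

lemmas E_add = clinear_onD(7) [OF E_lin, OF _ UNIV_I UNIV_I]
  and E_scaleC = clinear_onD(8) [OF E_lin, OF _ UNIV_I]
  and E_scaleR = clinear_onD(9) [OF E_lin, OF _ UNIV_I]
  and E_minus = clinear_onD(10) [OF E_lin, OF _ UNIV_I]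
  and E_diff = clinear_onD(11) [OF E_lin, OF _ UNIV_I UNIV_I]
  and E_zero = clinear_onD(12) [OF E_lin]

lemma E_inner: "B \<in> sets M \<Longrightarrow> inner (E B x) y = inner x (E B y)"
  using E_sym [of B x y] by (simp flip: Re_cinner)

lemma E_norm_sq: "B \<in> sets M \<Longrightarrow> inner (E B x) x = (norm (E B x))\<^sup>2"
  by (metis E_idem E_inner power2_norm_eq_inner)

lemma E_norm_le: assumes "B \<in> sets M" shows "norm (E B x) \<le> norm x"
proof -
  have "(norm (E B x))\<^sup>2 \<le> norm (E B x) * norm x"
    using norm_cauchy_schwarz [of "E B x" x] by (simp add: E_norm_sq [OF assms])
  then show ?thesis
    by (cases "norm (E B x) = 0") (auto simp: power2_eq_square)
qed

lemma E_bounded_linear: "B \<in> sets M \<Longrightarrow> bounded_linear (E B)"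
  by (rule bounded_linear_intro [of _ 1]) (auto simp: E_add E_scaleR E_norm_le)

lemma E_sum: "B \<in> sets M \<Longrightarrow> E B (sum g I) = (\<Sum>i\<in>I. E B (g i))"
  using linear_sum [OF bounded_linear.linear [OF E_bounded_linear]] by blast

lemma E_empty: "E {} x = 0"
proof -
  have "(\<lambda>n::nat. E {} x) sums E (\<Union>n::nat. {}) x"
    by (rule E_sums) (auto simp: disjoint_family_on_def)
  then have "summable (\<lambda>n::nat. E {} x)" by (rule sums_summable)
  then show ?thesis by (simp add: summable_const_iff)
qed

lemma E_Un:
  assumes "B \<in> sets M" "C \<in> sets M" "B \<inter> C = {}"
  shows "E (B \<union> C) x = E B x + E C x"
proof -
  have "(\<lambda>n. E (binaryset B C n) x) sums E (\<Union>n. binaryset B C n) x"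
    by (rule E_sums) (use assms in \<open>auto simp: disjoint_family_on_def binaryset_def\<close>)
  moreover have "(\<lambda>n. E (binaryset B C n) x) sums (E B x + E C x)"
    by (rule binaryset_sums [where f = "\<lambda>B. E B x"]) (rule E_empty)
  ultimately show ?thesis by (simp add: UN_binaryset_eq sums_iff)
qed

text \<open>Additivity gives Pythagoras: at \<open>?y = E B x\<close> the squared norm of
  \<open>E (B \<union> C) ?y\<close> is that of \<open>?y\<close> plus that of
  \<open>E C ?y\<close>. Since projections are contractions, the last term vanishes.\<close>

lemma E_disjoint:
  assumes B: "B \<in> sets M" and C: "C \<in> sets M" and BC: "B \<inter> C = {}"
  shows "E C (E B x) = 0"
proof -
  let ?y = "E B x"
  have "inner (E (B \<union> C) ?y) ?y = inner (E B ?y) ?y + inner (E C ?y) ?y"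
    by (simp add: E_Un [OF assms] inner_add_left)
  then have "(norm (E (B \<union> C) ?y))\<^sup>2 = (norm ?y)\<^sup>2 + (norm (E C ?y))\<^sup>2"
    using B C by (simp add: E_norm_sq E_idem flip: power2_norm_eq_inner)
  moreover have "(norm (E (B \<union> C) ?y))\<^sup>2 \<le> (norm ?y)\<^sup>2"
    using E_norm_le [of "B \<union> C" ?y] B C by (intro power_mono) auto
  ultimately show ?thesis by simp
qed

text \<open>Multiplicativity follows from additivity: both sets are split along their intersection,
  and the cross terms vanish by \<open>E_disjoint\<close>.\<close>

lemma E_Int:
  assumes B: "B \<in> sets M" and C: "C \<in> sets M"
  shows "E B (E C x) = E (B \<inter> C) x"
proof -
  have C': "E C x = E (B \<inter> C) x + E (C - B) x"
    using E_Un [of "B \<inter> C" "C - B" x] B C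
    by (metis Diff_disjoint Int_Diff Int_commute Un_Diff_Int Un_commute Int_assoc Int_empty_right sets.Diff sets.Int)
  have B': "E B y = E (B \<inter> C) y + E (B - C) y" for y
    using E_Un [of "B \<inter> C" "B - C" y] B C by (simp add: Int_Diff_disjoint Un_Diff_Int Un_commute)
  have 1: "E (B - C) (E (B \<inter> C) x) = 0" by (rule E_disjoint) (use B C in auto)
  have 2: "E B (E (C - B) x) = 0" by (rule E_disjoint) (use B C in auto)
  show ?thesis
    by (subst C') (use B C in \<open>simp add: E_add 2 B' [of "E (B \<inter> C) x"] 1 E_idem sets.Int\<close>)
qed

lemma E_commute:
  assumes "B \<in> sets M" "C \<in> sets M"
  shows "E B (E C x) = E C (E B x)"
  using assms by (simp add: E_Int Int_commute)

lemma E_Compl: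
  assumes "B \<in> sets M"
  shows "E (space M - B) x = x - E B x"
  using E_Un [of B "space M - B" x] assms E_space [of x] sets.sets_into_space [OF assms]
  by (simp add: Un_absorb1 add.commute eq_diff_eq)

section \<open>Scalar spectral measures\<close>

lemma space_scalar_measure [simp]: "space (\<mu> x) = space M"
  and sets_scalar_measure [simp, measurable_cong]: "sets (\<mu> x) = sets M"
  unfolding scalar_measure_def by (auto simp: space_measure_of_conv sets.space_closed)

text \<open>\<open>measure_of\<close> defaults to the zero measure unless its argument is positive
  and countably additive, so both have to be verified before the intended values are
  available.\<close>

lemma emeasure_scalar_measure:
  assumes B: "B \<in> sets M"
  shows "emeasure (\<mu> x) B = ennreal (inner (E B x) x)"
proof -
  have "positive (sets M) (\<lambda>B. ennreal (Re (cinner (E B x) x)))"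
    by (simp add: positive_def E_empty)
  moreover have "countably_additive (sets M) (\<lambda>B. ennreal (Re (cinner (E B x) x)))"
    unfolding countably_additive_def
  proof (intro allI impI)
    fix F :: "nat \<Rightarrow> 's set"
    assume F: "range F \<subseteq> sets M" "disjoint_family F"
    have s: "(\<lambda>n. inner (E (F n) x) x) sums inner (E (\<Union>n. F n) x) x"
      using bounded_linear.sums [OF bounded_linear_inner_left E_sums [OF F]] .
    have nn: "0 \<le> inner (E (F n) x) x" for n using F by (subst E_norm_sq) auto
    show "(\<Sum>i. ennreal (Re (cinner (E (F i) x) x))) = ennreal (Re (cinner (E (\<Union> (range F)) x) x))"
      unfolding Re_cinner using suminf_ennreal2 [OF nn sums_summable [OF s]] sums_unique [OF s] by simp
  qed
  ultimately show ?thesis unfolding scalar_measure_def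
    using B by (subst emeasure_measure_of_sigma) (auto simp: sets.sigma_algebra_axioms Re_cinner)
qed

lemma measure_scalar_measure: "B \<in> sets M \<Longrightarrow> measure (\<mu> x) B = inner (E B x) x"
  by (simp add: measure_def emeasure_scalar_measure E_norm_sq)

lemma finite_scalar_measure: "finite_measure (\<mu> x)"
  by (rule finite_measureI) (simp add: emeasure_scalar_measure)

lemma measure_space_scalar_measure: "measure (\<mu> x) (space M) = (norm x)\<^sup>2"
  by (simp add: measure_scalar_measure E_space power2_norm_eq_inner)

lemma AE_scalar_measure:
  assumes B: "B \<in> sets M" and x: "E B x = x"
  shows "AE s in \<mu> x. s \<in> B"
proof (rule AE_I [of _ _ "space M - B"])
  show "{s \<in> space (\<mu> x). s \<notin> B} \<subseteq> space M - B" by auto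
  show "emeasure (\<mu> x) (space M - B) = 0"
    using B x by (simp add: emeasure_scalar_measure E_Compl)
qed (use B in auto)

section \<open>Spectral integrals of simple functions\<close>

definition step_int :: "('s \<Rightarrow> real) \<Rightarrow> 'a \<Rightarrow> 'a" where
  "step_int h x = (\<Sum>c\<in>h ` space M. c *\<^sub>R E (h -` {c} \<inter> space M) x)"

lemma step_int_lin: "simple_function M h \<Longrightarrow> clinear_on UNIV (step_int h)"
  unfolding clinear_on_def csubspace_def step_int_def
  by (auto simp: simple_functionD E_add E_scaleC scaleR_add_right sum.distrib scaleC_sum_right
      simp flip: scaleC_scaleR)

lemma E_step_int:
  "simple_function M h \<Longrightarrow> B \<in> sets M \<Longrightarrow> E B (step_int h x) = step_int h (E B x)"
  unfolding step_int_def
  by (simp add: E_sum E_scaleR E_commute simple_functionD)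

lemma step_int_sym:
  "simple_function M h \<Longrightarrow> cinner (step_int h x) y = cinner x (step_int h y)"
  unfolding step_int_def
  by (simp add: cinner_sum_left cinner_sum_right cinner_scaleR_left cinner_scaleR_right E_sym
      simple_functionD)

lemma simple_function_eq_sum:
  fixes h :: "'s \<Rightarrow> real"
  assumes "simple_function M h" "s \<in> space M"
  shows "h s = (\<Sum>c\<in>h ` space M. c * indicator (h -` {c} \<inter> space M) s)"
proof -
  have "(\<Sum>c\<in>h ` space M. c * indicator (h -` {c} \<inter> space M) s) =
    (\<Sum>c\<in>h ` space M. if c = h s then c else 0)"
    using assms(2) by (intro sum.cong) (auto simp: indicator_def)
  also have "\<dots> = h s"
    using assms by (subst sum.delta) (auto dest: simple_functionD)
  finally show ?thesis by simp
qed

lemma integrable_indicator_scalar: "B \<in> sets M \<Longrightarrow> integrable (\<mu> x) (indicator B :: 's \<Rightarrow> real)"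
  using finite_measure.emeasure_finite [OF finite_scalar_measure]
  by (intro integrable_real_indicator) (auto simp: top.not_eq_extremum)

text \<open>Products of projections collapse to the projection of the intersection, so for fixed
  \<open>x\<close> the map from \<open>h\<close> to \<open>step_int h x\<close> is an isometry for
  the L^2 norm of \<open>\<mu> x\<close>. All convergence in the calculus rests on this.\<close>

lemma inner_step_int:
  assumes h: "simple_function M h" and k: "simple_function M k"
  shows "inner (step_int h x) (step_int k x) = (\<integral>s. h s * k s \<partial>\<mu> x)"
proof -
  let ?B = "\<lambda>h c. h -` {c} \<inter> space M"
  have meas: "?B h c \<in> sets M" "?B k c \<in> sets M" for c using h k by (auto simp: simple_functionD)
  have int: "integrable (\<mu> x) (\<lambda>s. c * d * indicator (?B h c \<inter> ?B k d) s :: real)"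
    and val: "(\<integral>s. c * d * indicator (?B h c \<inter> ?B k d) s \<partial>\<mu> x) = c * d * measure (\<mu> x) (?B h c \<inter> ?B k d)"
    for c d :: real
  proof -
    have "?B h c \<inter> ?B k d \<in> sets M" using meas by blast
    from integrable_indicator_scalar [OF this, of x] this
    show "integrable (\<mu> x) (\<lambda>s. c * d * indicator (?B h c \<inter> ?B k d) s :: real)"
      "(\<integral>s. c * d * indicator (?B h c \<inter> ?B k d) s \<partial>\<mu> x) = c * d * measure (\<mu> x) (?B h c \<inter> ?B k d)"
      by (simp_all add: Int_absorb2 sets.sets_into_space)
  qed
  have "(\<integral>s. h s * k s \<partial>\<mu> x) =
    (\<integral>s. (\<Sum>c\<in>h ` space M. \<Sum>d\<in>k ` space M. c * d * indicator (?B h c \<inter> ?B k d) s) \<partial>\<mu> x)"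
  proof (rule Bochner_Integration.integral_cong)
    fix s assume "s \<in> space (\<mu> x)"
    then have s: "s \<in> space M" by simp
    show "h s * k s = (\<Sum>c\<in>h ` space M. \<Sum>d\<in>k ` space M. c * d * indicator (?B h c \<inter> ?B k d) s)"
      unfolding simple_function_eq_sum [OF h s] simple_function_eq_sum [OF k s]
      by (simp only: sum_product indicator_inter_arith mult.assoc mult.left_commute)
  qed simp
  also have "\<dots> = (\<Sum>c\<in>h ` space M. \<Sum>d\<in>k ` space M. c * d * measure (\<mu> x) (?B h c \<inter> ?B k d))"
    by (simp only: Bochner_Integration.integral_sum Bochner_Integration.integrable_sum int val)
  also have "\<dots> = inner (step_int h x) (step_int k x)"
    unfolding step_int_def inner_sum_left
    unfolding inner_sum_right
    using meas by (intro sum.cong refl) (simp add: measure_scalar_measure E_Int [symmetric] E_inner E_commute)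
  finally show ?thesis by simp
qed

lemma step_int_one: "step_int (\<lambda>_. 1) x = x"
proof (cases "space M = {}")
  case True
  then show ?thesis using E_space [of x] by (simp add: step_int_def E_empty)
next
  case False
  then show ?thesis by (simp add: step_int_def E_space image_constant_conv)
qed

lemma inner_step_int_self:
  assumes "simple_function M h"
  shows "inner (step_int h x) x = (\<integral>s. h s \<partial>\<mu> x)"
  using inner_step_int [OF assms simple_function_const, of x 1] by (simp add: step_int_one)

lemma integrable_simple_scalar:
  assumes "simple_function M (h :: 's \<Rightarrow> real)"
  shows "integrable (\<mu> x) h"
proof -
  interpret finite_measure "\<mu> x" by (rule finite_scalar_measure)
  have fin: "finite (h ` space M)" using assms by (rule simple_functionD)
  show ?thesis
  proof (rule integrable_const_bound [where B = "Max ((\<lambda>c. \<bar>c\<bar>) ` h ` space M)"])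
    show "AE s in \<mu> x. norm (h s) \<le> Max ((\<lambda>c. \<bar>c\<bar>) ` h ` space M)"
      using fin by (intro AE_I2) auto
    show "h \<in> borel_measurable (\<mu> x)"
      using borel_measurable_simple_function [OF assms] by simp
  qed
qed

lemma norm_step_int_diff:
  assumes h: "simple_function M h" and k: "simple_function M k"
  shows "(norm (step_int h x - step_int k x))\<^sup>2 = (\<integral>s. (h s - k s)\<^sup>2 \<partial>\<mu> x)"
proof -
  have hh: "simple_function M (\<lambda>s. p s * q s)" if "simple_function M p" "simple_function M q" for p q :: "'s \<Rightarrow> real"
    using that by (rule simple_function_mult)
  note int = integrable_simple_scalar [OF hh]
  have "(\<integral>s. (h s - k s)\<^sup>2 \<partial>\<mu> x) = (\<integral>s. h s * h s - 2 * (h s * k s) + k s * k s \<partial>\<mu> x)"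
    by (intro Bochner_Integration.integral_cong) (auto simp: power2_eq_square algebra_simps)
  also have "\<dots> = (\<integral>s. h s * h s \<partial>\<mu> x) - 2 * (\<integral>s. h s * k s \<partial>\<mu> x) + (\<integral>s. k s * k s \<partial>\<mu> x)"
    using int [OF h h] int [OF h k] int [OF k k] by simp
  also have "\<dots> = (norm (step_int h x - step_int k x))\<^sup>2"
    using h k by (simp add: inner_step_int [symmetric] power2_norm_eq_inner inner_diff_left inner_diff_right inner_commute)
  finally show ?thesis ..
qed

text \<open>The sequence is chosen from \<open>g\<close> alone, so each
  \<open>step_int (simple_approx g n)\<close> is one linear operator serving all vectors. The bound
  \<open>2 * \<bar>g s\<bar>\<close> provides the dominating functions for the limits.\<close>

definition simple_approx :: "('s \<Rightarrow> real) \<Rightarrow> nat \<Rightarrow> 's \<Rightarrow> real" where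
  "simple_approx g = (SOME F. (\<forall>n. simple_function M (F n)) \<and>
    (\<forall>s\<in>space M. (\<lambda>n. F n s) \<longlonglongrightarrow> g s) \<and> (\<forall>n. \<forall>s\<in>space M. \<bar>F n s\<bar> \<le> 2 * \<bar>g s\<bar>))"

lemma simple_approx:
  assumes "g \<in> borel_measurable M"
  shows "simple_function M (simple_approx g n)"
    and "s \<in> space M \<Longrightarrow> (\<lambda>n. simple_approx g n s) \<longlonglongrightarrow> g s"
    and "s \<in> space M \<Longrightarrow> \<bar>simple_approx g n s\<bar> \<le> 2 * \<bar>g s\<bar>"
proof -
  have "\<exists>F. (\<forall>n. simple_function M (F n)) \<and>
    (\<forall>s\<in>space M. (\<lambda>n. F n s) \<longlonglongrightarrow> g s) \<and> (\<forall>n. \<forall>s\<in>space M. \<bar>F n s\<bar> \<le> 2 * \<bar>g s\<bar>)"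
    using borel_measurable_implies_sequence_metric [OF assms, of 0] by (simp add: dist_norm)
  from someI_ex [OF this, folded simple_approx_def]
  show "simple_function M (simple_approx g n)"
    and "s \<in> space M \<Longrightarrow> (\<lambda>n. simple_approx g n s) \<longlonglongrightarrow> g s"
    and "s \<in> space M \<Longrightarrow> \<bar>simple_approx g n s\<bar> \<le> 2 * \<bar>g s\<bar>" by auto
qed

section \<open>Domains of unbounded spectral integrals\<close>

lemma mem_domD: "x \<in> dom g \<Longrightarrow> integrable (\<mu> x) (\<lambda>s. (g s)\<^sup>2)"
  by (simp add: fcalc_dom_def)

lemma integrable_of_dom:
  assumes g: "g \<in> borel_measurable M" and x: "x \<in> dom g"
  shows "integrable (\<mu> x) g"
proof (rule Bochner_Integration.integrable_bound)
  interpret finite_measure "\<mu> x" by (rule finite_scalar_measure)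
  show "integrable (\<mu> x) (\<lambda>s. 1 + (g s)\<^sup>2)" using mem_domD [OF x] by simp
  show "g \<in> borel_measurable (\<mu> x)" using g by simp
  have "\<bar>a\<bar> \<le> 1 + a\<^sup>2" for a :: real
    using zero_le_power2 [of "\<bar>a\<bar> - 1"] by (simp add: power2_eq_square algebra_simps)
  then show "AE s in \<mu> x. norm (g s) \<le> norm (1 + (g s)\<^sup>2)" by (intro AE_I2) (simp add: abs_of_nonneg)
qed

lemma norm_step_approx:
  assumes g: "g \<in> borel_measurable M"
  shows "ennreal ((norm (step_int (simple_approx g n) x))\<^sup>2) = (\<integral>\<^sup>+ s. ennreal ((simple_approx g n s)\<^sup>2) \<partial>\<mu> x)"
proof -
  note F = simple_approx(1) [OF g, of n]
  have "integrable (\<mu> x) (\<lambda>s. (simple_approx g n s)\<^sup>2)"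
    unfolding power2_eq_square by (rule integrable_simple_scalar) (rule simple_function_mult [OF F F])
  then show ?thesis
    unfolding power2_norm_eq_inner inner_step_int [OF F F]
    by (subst nn_integral_eq_integral) (simp_all add: power2_eq_square)
qed

text \<open>Membership in the domain is expressed by the boundedness of a sequence of vectors that
  depends linearly on \<open>x\<close>; this makes it evident that the domain is a subspace.\<close>

lemma dom_iff_bounded:
  assumes g: "g \<in> borel_measurable M"
  shows "x \<in> dom g \<longleftrightarrow> (\<exists>K. \<forall>n. norm (step_int (simple_approx g n) x) \<le> K)"
proof
  let ?F = "simple_approx g"
  assume x: "x \<in> dom g"
  have "(norm (step_int (?F n) x))\<^sup>2 \<le> (\<integral>s. 4 * (g s)\<^sup>2 \<partial>\<mu> x)" for n
  proof -
    have F: "simple_function M (?F n)" by (rule simple_approx [OF g])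
    have "(norm (step_int (?F n) x))\<^sup>2 = (\<integral>s. ?F n s * ?F n s \<partial>\<mu> x)"
      by (simp add: power2_norm_eq_inner inner_step_int [OF F F])
    also have "\<dots> \<le> (\<integral>s. 4 * (g s)\<^sup>2 \<partial>\<mu> x)"
    proof (rule integral_mono)
      show "integrable (\<mu> x) (\<lambda>s. ?F n s * ?F n s)"
        by (rule integrable_simple_scalar) (rule simple_function_mult [OF F F])
      show "integrable (\<mu> x) (\<lambda>s. 4 * (g s)\<^sup>2)" using mem_domD [OF x] by simp
      fix s assume "s \<in> space (\<mu> x)"
      then have "\<bar>?F n s\<bar>\<^sup>2 \<le> (2 * \<bar>g s\<bar>)\<^sup>2" using simple_approx(3) [OF g] by (intro power_mono) auto
      then show "?F n s * ?F n s \<le> 4 * (g s)\<^sup>2" by (simp add: power2_eq_square)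
    qed
    finally show ?thesis .
  qed
  then show "\<exists>K. \<forall>n. norm (step_int (?F n) x) \<le> K" using real_le_rsqrt by blast
next
  let ?F = "simple_approx g"
  assume "\<exists>K. \<forall>n. norm (step_int (?F n) x) \<le> K"
  then obtain K where K: "\<And>n. norm (step_int (?F n) x) \<le> K" by blast
  have [measurable]: "?F n \<in> borel_measurable M" for n
    by (intro borel_measurable_simple_function simple_approx g)
  have [measurable]: "g \<in> borel_measurable M" by (rule g)
  have "(\<integral>\<^sup>+ s. ennreal ((g s)\<^sup>2) \<partial>\<mu> x) = (\<integral>\<^sup>+ s. liminf (\<lambda>n. ennreal ((?F n s)\<^sup>2)) \<partial>\<mu> x)"
  proof (rule nn_integral_cong)
    fix s assume "s \<in> space (\<mu> x)"
    then have "(\<lambda>n. ?F n s) \<longlonglongrightarrow> g s" using simple_approx(2) [OF g] by simp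
    then have "(\<lambda>n. ennreal ((?F n s)\<^sup>2)) \<longlonglongrightarrow> ennreal ((g s)\<^sup>2)"
      by (intro tendsto_ennrealI tendsto_power)
    then show "ennreal ((g s)\<^sup>2) = liminf (\<lambda>n. ennreal ((?F n s)\<^sup>2))"
      by (intro lim_imp_Liminf[symmetric]) auto
  qed
  also have "\<dots> \<le> liminf (\<lambda>n. \<integral>\<^sup>+ s. ennreal ((?F n s)\<^sup>2) \<partial>\<mu> x)"
    by (rule nn_integral_liminf) measurable
  also have "\<dots> \<le> liminf (\<lambda>n. ennreal (K\<^sup>2))"
  proof (rule Liminf_mono, rule always_eventually, rule allI)
    fix n show "(\<integral>\<^sup>+ s. ennreal ((?F n s)\<^sup>2) \<partial>\<mu> x) \<le> ennreal (K\<^sup>2)"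
      unfolding norm_step_approx [OF g, symmetric]
      by (intro ennreal_leI power_mono K) simp
  qed
  also have "\<dots> < \<infinity>" by (simp add: Liminf_const)
  finally have "integrable (\<mu> x) (\<lambda>s. (g s)\<^sup>2)" by (intro integrableI_nonneg) auto
  then show "x \<in> dom g" by (simp add: fcalc_dom_def)
qed

lemma csubspace_dom:
  assumes g: "g \<in> borel_measurable M"
  shows "csubspace (dom g)"
  unfolding csubspace_def
proof (intro conjI ballI allI)
  let ?I = "\<lambda>n. step_int (simple_approx g n)"
  note lin = clinear_onD [OF step_int_lin [OF simple_approx(1) [OF g]]]
  show "0 \<in> dom g" unfolding dom_iff_bounded [OF g] by (rule exI [of _ 0]) (simp add: lin)
  fix x assume "x \<in> dom g"
  then obtain K where K: "\<And>n. norm (?I n x) \<le> K" unfolding dom_iff_bounded [OF g] by blast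
  show "c *\<^sub>C x \<in> dom g" for c
    unfolding dom_iff_bounded [OF g]
    using K by (intro exI [of _ "cmod c * K"]) (simp add: lin norm_scaleC mult_left_mono)
  fix y assume "y \<in> dom g"
  then obtain L where L: "\<And>n. norm (?I n y) \<le> L" unfolding dom_iff_bounded [OF g] by blast
  show "x + y \<in> dom g"
    unfolding dom_iff_bounded [OF g]
    using K L by (intro exI [of _ "K + L"]) (auto simp: lin intro: norm_triangle_mono)
qed

lemma E_in_dom:
  assumes g: "g \<in> borel_measurable M" and B: "B \<in> sets M" and x: "x \<in> dom g"
  shows "E B x \<in> dom g"
proof -
  from x obtain K where K: "\<And>n. norm (step_int (simple_approx g n) x) \<le> K"
    unfolding dom_iff_bounded [OF g] by blast
  have "norm (step_int (simple_approx g n) (E B x)) \<le> K" for n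
    using E_norm_le [OF B] K [of n]
    by (auto simp: E_step_int [OF simple_approx(1) [OF g] B, symmetric] intro: order_trans)
  then show ?thesis unfolding dom_iff_bounded [OF g] by blast
qed

lemma integrable_bounded_on:
  fixes g :: "'s \<Rightarrow> real"
  assumes g: "g \<in> borel_measurable M" and B: "B \<in> sets M" and x: "E B x = x"
    and K: "\<And>s. s \<in> B \<Longrightarrow> \<bar>g s\<bar> \<le> K"
  shows "integrable (\<mu> x) g"
proof -
  interpret finite_measure "\<mu> x" by (rule finite_scalar_measure)
  show ?thesis
    using AE_scalar_measure [OF B x] g
    by (intro integrable_const_bound [where B = K]) (auto elim!: eventually_mono simp: K)
qed

lemma dom_bounded:
  assumes g: "g \<in> borel_measurable M" and B: "B \<in> sets M" and x: "E B x = x"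
    and K: "\<And>s. s \<in> B \<Longrightarrow> \<bar>g s\<bar> \<le> K"
  shows "x \<in> dom g"
  unfolding fcalc_dom_def mem_Collect_eq
proof (rule integrable_bounded_on [OF _ B x])
  show "(\<lambda>s. (g s)\<^sup>2) \<in> borel_measurable M" using g by simp
  fix s assume "s \<in> B"
  then have "\<bar>g s\<bar>\<^sup>2 \<le> K\<^sup>2" using K by (intro power_mono) auto
  then show "\<bar>(g s)\<^sup>2\<bar> \<le> K\<^sup>2" by simp
qed

text \<open>Strong convergence comes from continuity of the finite measure \<open>\<mu> x\<close>
  from below: for nested sets the difference of the measures is the squared norm of the difference
  of the projected vectors.\<close>

lemma E_increasing_tendsto:
  assumes B: "\<And>n. B n \<in> sets M" and inc: "incseq B"
  shows "(\<lambda>n. E (B n) x) \<longlonglongrightarrow> E (\<Union>n. B n) x"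
proof -
  let ?U = "\<Union>n. B n"
  interpret finite_measure "\<mu> x" by (rule finite_scalar_measure)
  have U: "?U \<in> sets M" using B by blast
  have "(\<lambda>n. measure (\<mu> x) (B n)) \<longlonglongrightarrow> measure (\<mu> x) ?U"
    using B inc by (intro finite_Lim_measure_incseq) auto
  then have "(\<lambda>n. measure (\<mu> x) ?U - measure (\<mu> x) (B n)) \<longlonglongrightarrow> 0"
    using tendsto_diff [OF tendsto_const, of _ "measure (\<mu> x) ?U" sequentially "measure (\<mu> x) ?U"] by simp
  moreover have "measure (\<mu> x) ?U - measure (\<mu> x) (B n) = (norm (E (B n) x - E ?U x))\<^sup>2" for n
  proof -
    have "B n \<inter> ?U = B n" by auto
    then have "E (B n) (E ?U x) = E (B n) x" using E_Int [OF B U, of n x] by simp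
    then have "inner (E (B n) x) (E ?U x) = inner (E (B n) x) x"
      using E_inner [OF B, of n x "E ?U x"] E_inner [OF B, of n x x] by simp
    then have "inner (E (B n) x) (E ?U x) = (norm (E (B n) x))\<^sup>2" by (simp add: E_norm_sq [OF B])
    moreover have "(norm (E (B n) x - E ?U x))\<^sup>2 =
      (norm (E (B n) x))\<^sup>2 - 2 * inner (E (B n) x) (E ?U x) + (norm (E ?U x))\<^sup>2"
      by (simp add: power2_norm_eq_inner inner_diff_left inner_diff_right inner_commute)
    ultimately show ?thesis
      by (simp add: measure_scalar_measure [OF B] measure_scalar_measure [OF U] E_norm_sq [OF B] E_norm_sq [OF U])
  qed
  ultimately have "(\<lambda>n. (norm (E (B n) x - E ?U x))\<^sup>2) \<longlonglongrightarrow> 0" by simp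
  then have "(\<lambda>n. norm (E (B n) x - E ?U x)) \<longlonglongrightarrow> 0"
    using tendsto_real_sqrt by fastforce
  then show ?thesis using LIM_zero_cancel tendsto_norm_zero_iff by blast
qed

lemma truncation_tendsto:
  assumes g: "g \<in> borel_measurable M"
  shows "(\<lambda>n. E {s \<in> space M. \<bar>g s\<bar> \<le> real n} x) \<longlonglongrightarrow> x"
proof -
  have "(\<Union>n. {s \<in> space M. \<bar>g s\<bar> \<le> real n}) = space M"
    using real_arch_simple by auto
  moreover have "incseq (\<lambda>n. {s \<in> space M. \<bar>g s\<bar> \<le> real n})"
    by (rule monoI) force
  ultimately show ?thesis
    using E_increasing_tendsto [of "\<lambda>n. {s \<in> space M. \<bar>g s\<bar> \<le> real n}" x] g
    by (simp add: E_space)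
qed

lemma dom_dense:
  assumes g: "g \<in> borel_measurable M"
  shows "closure (dom g) = UNIV"
proof -
  have "x \<in> closure (dom g)" for x
    unfolding closure_sequential
  proof (intro exI conjI allI)
    show "(\<lambda>n. E {s \<in> space M. \<bar>g s\<bar> \<le> real n} x) \<longlonglongrightarrow> x" by (rule truncation_tendsto [OF g])
    fix n
    show "E {s \<in> space M. \<bar>g s\<bar> \<le> real n} x \<in> dom g"
      using g by (intro dom_bounded [OF g, of "{s \<in> space M. \<bar>g s\<bar> \<le> real n}" _ n]) (auto simp: E_idem)
  qed
  then show ?thesis by blast
qed

section \<open>From simple to unbounded functions\<close>

lemma dominated_approx:
  assumes g: "g \<in> borel_measurable M" and x: "x \<in> dom g"
  shows "(\<lambda>n. \<integral>s. simple_approx g n s \<partial>\<mu> x) \<longlonglongrightarrow> (\<integral>s. g s \<partial>\<mu> x)"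
    and "(\<lambda>n. \<integral>s. (simple_approx g n s)\<^sup>2 \<partial>\<mu> x) \<longlonglongrightarrow> (\<integral>s. (g s)\<^sup>2 \<partial>\<mu> x)"
    and "(\<lambda>n. \<integral>s. (simple_approx g n s - g s)\<^sup>2 \<partial>\<mu> x) \<longlonglongrightarrow> 0"
    and "integrable (\<mu> x) (\<lambda>s. (simple_approx g n s - g s)\<^sup>2)"
proof -
  let ?F = "simple_approx g"
  have [measurable]: "?F n \<in> borel_measurable M" for n
    by (intro borel_measurable_simple_function simple_approx g)
  have [measurable]: "g \<in> borel_measurable M" by (rule g)
  note lim = simple_approx(2) [OF g] and bd = simple_approx(3) [OF g]
  note int = mem_domD [OF x] integrable_of_dom [OF g x]
  show "(\<lambda>n. \<integral>s. ?F n s \<partial>\<mu> x) \<longlonglongrightarrow> (\<integral>s. g s \<partial>\<mu> x)"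
    by (rule integral_dominated_convergence [where w = "\<lambda>s. 2 * \<bar>g s\<bar>"]) (use int lim bd in auto)
  have bd2: "(?F n s)\<^sup>2 \<le> 4 * (g s)\<^sup>2" if "s \<in> space M" for n s
  proof -
    have "\<bar>?F n s\<bar>\<^sup>2 \<le> (2 * \<bar>g s\<bar>)\<^sup>2" using bd [OF that] by (intro power_mono) auto
    then show ?thesis by simp
  qed
  show "(\<lambda>n. \<integral>s. (?F n s)\<^sup>2 \<partial>\<mu> x) \<longlonglongrightarrow> (\<integral>s. (g s)\<^sup>2 \<partial>\<mu> x)"
    by (rule integral_dominated_convergence [where w = "\<lambda>s. 4 * (g s)\<^sup>2"])
      (use int lim bd2 in \<open>auto intro!: tendsto_power\<close>)
  have bd3: "(?F n s - g s)\<^sup>2 \<le> 9 * (g s)\<^sup>2" if "s \<in> space M" for n s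
  proof -
    have "\<bar>?F n s - g s\<bar>\<^sup>2 \<le> (3 * \<bar>g s\<bar>)\<^sup>2" using bd [OF that, of n] by (intro power_mono) auto
    then show ?thesis by (simp add: power_mult_distrib)
  qed
  have w: "integrable (\<mu> x) (\<lambda>s. 9 * (g s)\<^sup>2)" using int by simp
  have "(\<lambda>n. \<integral>s. (?F n s - g s)\<^sup>2 \<partial>\<mu> x) \<longlonglongrightarrow> (\<integral>s. 0 \<partial>\<mu> x)"
  proof (rule integral_dominated_convergence [OF _ _ w])
    show "AE s in \<mu> x. (\<lambda>n. (?F n s - g s)\<^sup>2) \<longlonglongrightarrow> 0"
    proof (rule AE_I2)
      fix s assume "s \<in> space (\<mu> x)"
      then have "(\<lambda>n. ?F n s - g s) \<longlonglongrightarrow> 0" using lim LIM_zero by force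
      then show "(\<lambda>n. (?F n s - g s)\<^sup>2) \<longlonglongrightarrow> 0" using tendsto_power [of _ 0 _ 2] by force
    qed
  qed (use bd3 in auto)
  then show "(\<lambda>n. \<integral>s. (?F n s - g s)\<^sup>2 \<partial>\<mu> x) \<longlonglongrightarrow> 0" by simp
  show "integrable (\<mu> x) (\<lambda>s. (?F n s - g s)\<^sup>2)"
    by (rule Bochner_Integration.integrable_bound [OF w]) (use bd3 in auto)
qed

lemma step_approx_convergent:
  assumes g: "g \<in> borel_measurable M" and x: "x \<in> dom g"
  shows "convergent (\<lambda>n. step_int (simple_approx g n) x)"
proof (rule Cauchy_convergent, rule metric_CauchyI)
  let ?F = "simple_approx g"
  fix e :: real assume e: "e > 0"
  then have "0 < e\<^sup>2 / 4" by simp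
  then have "\<forall>\<^sub>F n in sequentially. (\<integral>s. (?F n s - g s)\<^sup>2 \<partial>\<mu> x) < e\<^sup>2 / 4"
    by (rule order_tendstoD(2) [OF dominated_approx(3) [OF g x]])
  then obtain N where N: "\<And>n. n \<ge> N \<Longrightarrow> (\<integral>s. (?F n s - g s)\<^sup>2 \<partial>\<mu> x) < e\<^sup>2 / 4"
    by (auto simp: eventually_sequentially)
  have "dist (step_int (?F m) x) (step_int (?F n) x) < e" if mn: "m \<ge> N" "n \<ge> N" for m n
  proof -
    note int = dominated_approx(4) [OF g x]
    have "(norm (step_int (?F m) x - step_int (?F n) x))\<^sup>2 = (\<integral>s. (?F m s - ?F n s)\<^sup>2 \<partial>\<mu> x)"
      by (intro norm_step_int_diff simple_approx g)
    also have "\<dots> \<le> (\<integral>s. 2 * (?F m s - g s)\<^sup>2 + 2 * (?F n s - g s)\<^sup>2 \<partial>\<mu> x)"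
    proof (rule integral_mono)
      have "simple_function M (\<lambda>s. (?F m s - ?F n s) * (?F m s - ?F n s))"
        by (intro simple_function_mult simple_function_diff simple_approx g)
      then show "integrable (\<mu> x) (\<lambda>s. (?F m s - ?F n s)\<^sup>2)"
        unfolding power2_eq_square by (rule integrable_simple_scalar)
      show "integrable (\<mu> x) (\<lambda>s. 2 * (?F m s - g s)\<^sup>2 + 2 * (?F n s - g s)\<^sup>2)" using int by simp
      have "(a - b)\<^sup>2 \<le> 2 * (a - c)\<^sup>2 + 2 * (b - c)\<^sup>2" for a b c :: real
        using zero_le_power2 [of "a + b - 2 * c"] by (simp add: power2_eq_square algebra_simps)
      then show "(?F m s - ?F n s)\<^sup>2 \<le> 2 * (?F m s - g s)\<^sup>2 + 2 * (?F n s - g s)\<^sup>2" for s .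
    qed
    also have "\<dots> = 2 * (\<integral>s. (?F m s - g s)\<^sup>2 \<partial>\<mu> x) + 2 * (\<integral>s. (?F n s - g s)\<^sup>2 \<partial>\<mu> x)"
      using int by simp
    also have "\<dots> < e\<^sup>2" using N [OF mn(1)] N [OF mn(2)] by linarith
    finally show ?thesis using e by (simp add: dist_norm power2_less_imp_less)
  qed
  then show "\<exists>M. \<forall>m\<ge>M. \<forall>n\<ge>M. dist (step_int (?F m) x) (step_int (?F n) x) < e" by blast
qed

text \<open>The polarized form is an actual inner product for simple functions, since
  \<open>step_int h\<close> is symmetric and its quadratic form is therefore real.\<close>

lemma step_form:
  assumes h: "simple_function M h"
  shows "cinner (step_int h x) z = spectral_form M E h x z"
proof -
  have "complex_of_real (\<integral>s. h s \<partial>\<mu> y) = cinner (step_int h y) y" for y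
  proof -
    have "cinner (step_int h y) y = cnj (cinner (step_int h y) y)"
      using step_int_sym [OF h, of y y] cinner_commute by metis
    then have "Im (cinner (step_int h y) y) = 0" by (metis cnj.sel(2) neg_equal_zero)
    then show ?thesis
      by (simp add: complex_eq_iff Re_cinner inner_step_int_self [OF h])
  qed
  then show ?thesis
    unfolding spectral_form_def by (simp add: cinner_polarization [OF step_int_lin [OF h], of x z])
qed

text \<open>This eliminates the definite description. The limit satisfies the defining identity by
  dominated convergence at the four vectors \<open>x + \<i> ^ k *\<^sub>C z\<close>, which lie in
  the domain because it is a subspace; density of the domain gives uniqueness.\<close>

lemma step_approx_tendsto:
  assumes g: "g \<in> borel_measurable M" and x: "x \<in> dom g"
  shows "(\<lambda>n. step_int (simple_approx g n) x) \<longlonglongrightarrow> fcalc M E g x"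
proof -
  obtain y where y: "(\<lambda>n. step_int (simple_approx g n) x) \<longlonglongrightarrow> y"
    using step_approx_convergent [OF g x] convergent_def by blast
  have eq: "cinner y z = spectral_form M E g x z" if z: "z \<in> dom g" for z
  proof -
    have "(\<lambda>n. cinner (step_int (simple_approx g n) x) z) \<longlonglongrightarrow> spectral_form M E g x z"
      unfolding step_form [OF simple_approx(1) [OF g]] spectral_form_def
      using csubspace_dom [OF g] x z
      by (intro tendsto_intros dominated_approx g) (auto simp: csubspace_def)
    then show ?thesis using tendsto_cinner_left [OF y] LIMSEQ_unique by blast
  qed
  have "fcalc M E g x = y"
    unfolding fcalc_def
  proof (rule the_equality)
    show "\<forall>z\<in>dom g. cinner y z = spectral_form M E g x z" using eq by blast
    fix y' assume y': "\<forall>z\<in>dom g. cinner y' z = spectral_form M E g x z"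
    show "y' = y"
    proof (rule eq_of_cinner_dense [OF dom_dense [OF g]])
      fix z assume "z \<in> dom g"
      then have "cinner y' z = cinner y z" using y' eq by simp
      then show "cinner z y' = cinner z y" by (metis cinner_commute)
    qed
  qed
  with y show ?thesis by simp
qed

lemma fcalc_clinear:
  assumes g: "g \<in> borel_measurable M"
  shows "clinear_on (dom g) (fcalc M E g)"
  unfolding clinear_on_def
proof (intro conjI ballI allI)
  note lin = clinear_onD [OF step_int_lin [OF simple_approx(1) [OF g]]]
  note lim = step_approx_tendsto [OF g]
  show sub: "csubspace (dom g)" by (rule csubspace_dom [OF g])
  fix x assume x: "x \<in> dom g"
  show "fcalc M E g (c *\<^sub>C x) = c *\<^sub>C fcalc M E g x" for c
  proof (rule LIMSEQ_unique)
    show "(\<lambda>n. step_int (simple_approx g n) (c *\<^sub>C x)) \<longlonglongrightarrow> fcalc M E g (c *\<^sub>C x)"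
      using sub x by (intro lim) (auto simp: csubspace_def)
    show "(\<lambda>n. step_int (simple_approx g n) (c *\<^sub>C x)) \<longlonglongrightarrow> c *\<^sub>C fcalc M E g x"
      by (simp add: lin) (rule bounded_linear.tendsto [OF bounded_linear_scaleC_right lim [OF x]])
  qed
  fix y assume y: "y \<in> dom g"
  show "fcalc M E g (x + y) = fcalc M E g x + fcalc M E g y"
  proof (rule LIMSEQ_unique)
    show "(\<lambda>n. step_int (simple_approx g n) (x + y)) \<longlonglongrightarrow> fcalc M E g (x + y)"
      using sub x y by (intro lim) (auto simp: csubspace_def)
    show "(\<lambda>n. step_int (simple_approx g n) (x + y)) \<longlonglongrightarrow> fcalc M E g x + fcalc M E g y"
      by (simp add: lin) (intro tendsto_add lim x y)
  qed
qed

lemma fcalc_sym: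
  assumes g: "g \<in> borel_measurable M" and x: "x \<in> dom g" and y: "y \<in> dom g"
  shows "cinner (fcalc M E g x) y = cinner x (fcalc M E g y)"
  using tendsto_cinner_left [OF step_approx_tendsto [OF g x], of y]
    tendsto_cinner_right [OF step_approx_tendsto [OF g y], of x]
  by (simp add: step_int_sym simple_approx g LIMSEQ_unique)

lemma fcalc_E:
  assumes g: "g \<in> borel_measurable M" and B: "B \<in> sets M" and x: "x \<in> dom g"
  shows "fcalc M E g (E B x) = E B (fcalc M E g x)"
  using step_approx_tendsto [OF g E_in_dom [OF g B x]]
    bounded_linear.tendsto [OF E_bounded_linear [OF B] step_approx_tendsto [OF g x]]
  by (simp add: E_step_int simple_approx g B LIMSEQ_unique)

lemma norm_fcalc:
  assumes g: "g \<in> borel_measurable M" and x: "x \<in> dom g"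
  shows "(norm (fcalc M E g x))\<^sup>2 = (\<integral>s. (g s)\<^sup>2 \<partial>\<mu> x)"
proof -
  note F = simple_approx(1) [OF g]
  have "(\<lambda>n. (norm (step_int (simple_approx g n) x))\<^sup>2) \<longlonglongrightarrow> (norm (fcalc M E g x))\<^sup>2"
    by (intro tendsto_intros step_approx_tendsto g x)
  moreover have "(norm (step_int (simple_approx g n) x))\<^sup>2 = (\<integral>s. (simple_approx g n s)\<^sup>2 \<partial>\<mu> x)" for n
    by (simp add: power2_norm_eq_inner inner_step_int [OF F F]) (simp add: power2_eq_square)
  ultimately show ?thesis using dominated_approx(2) [OF g x] LIMSEQ_unique by simp
qed

lemma inner_fcalc:
  assumes g: "g \<in> borel_measurable M" and x: "x \<in> dom g"
  shows "inner (fcalc M E g x) x = (\<integral>s. g s \<partial>\<mu> x)"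
proof -
  have "(\<lambda>n. inner (step_int (simple_approx g n) x) x) \<longlonglongrightarrow> inner (fcalc M E g x) x"
    by (intro tendsto_intros step_approx_tendsto g x)
  then show ?thesis
    using dominated_approx(1) [OF g x] LIMSEQ_unique
    by (simp add: inner_step_int_self simple_approx g)
qed

section \<open>Estimates from the values of a function on a spectral set\<close>

lemma norm_fcalc_diff:
  assumes g: "g \<in> borel_measurable M" and x: "x \<in> dom g"
  shows "(norm (fcalc M E g x - c *\<^sub>R x))\<^sup>2 = (\<integral>s. (g s - c)\<^sup>2 \<partial>\<mu> x)"
proof -
  interpret finite_measure "\<mu> x" by (rule finite_scalar_measure)
  have "(\<integral>s. (g s - c)\<^sup>2 \<partial>\<mu> x) = (\<integral>s. (g s)\<^sup>2 - 2 * c * g s + c\<^sup>2 \<partial>\<mu> x)"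
    by (intro Bochner_Integration.integral_cong) (auto simp: power2_eq_square algebra_simps)
  also have "\<dots> = (\<integral>s. (g s)\<^sup>2 \<partial>\<mu> x) - 2 * c * (\<integral>s. g s \<partial>\<mu> x) + c\<^sup>2 * (norm x)\<^sup>2"
    using mem_domD [OF x] integrable_of_dom [OF g x] by (simp add: measure_space_scalar_measure)
  also have "\<dots> = (norm (fcalc M E g x - c *\<^sub>R x))\<^sup>2"
    unfolding norm_fcalc [OF g x, symmetric] inner_fcalc [OF g x, symmetric] power2_norm_eq_inner
    by (simp add: inner_diff_left inner_diff_right inner_commute power2_eq_square algebra_simps)
  finally show ?thesis ..
qed

lemma integrable_diff_sq:
  assumes g: "g \<in> borel_measurable M" and x: "x \<in> dom g"
  shows "integrable (\<mu> x) (\<lambda>s. (g s - c)\<^sup>2)"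
proof -
  interpret finite_measure "\<mu> x" by (rule finite_scalar_measure)
  have "integrable (\<mu> x) (\<lambda>s. (g s)\<^sup>2 - 2 * c * g s + c\<^sup>2)"
    using mem_domD [OF x] integrable_of_dom [OF g x] by simp
  also have "(\<lambda>s. (g s)\<^sup>2 - 2 * c * g s + c\<^sup>2) = (\<lambda>s. (g s - c)\<^sup>2)"
    by (auto simp: power2_eq_square algebra_simps)
  finally show ?thesis .
qed

lemma integral_const_scalar: "(\<integral>s. c \<partial>\<mu> x) = c * (norm x)\<^sup>2" "integrable (\<mu> x) (\<lambda>s. c::real)"
proof -
  interpret finite_measure "\<mu> x" by (rule finite_scalar_measure)
  show "(\<integral>s. c \<partial>\<mu> x) = c * (norm x)\<^sup>2" "integrable (\<mu> x) (\<lambda>s. c::real)"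
    by (simp_all add: measure_space_scalar_measure)
qed

lemma norm_fcalc_diff_le:
  assumes g: "g \<in> borel_measurable M" and x: "x \<in> dom g" and B: "B \<in> sets M" "E B x = x"
    and e: "\<And>s. s \<in> B \<Longrightarrow> \<bar>g s - c\<bar> \<le> e" "0 \<le> e"
  shows "norm (fcalc M E g x - c *\<^sub>R x) \<le> e * norm x"
proof -
  have "(norm (fcalc M E g x - c *\<^sub>R x))\<^sup>2 \<le> (\<integral>s. e\<^sup>2 \<partial>\<mu> x)"
    unfolding norm_fcalc_diff [OF g x]
  proof (rule integral_mono_AE)
    show "AE s in \<mu> x. (g s - c)\<^sup>2 \<le> e\<^sup>2"
      using AE_scalar_measure [OF B] by eventually_elim (metis e(1) abs_ge_zero power2_abs power_mono)
  qed (intro integrable_diff_sq g x integral_const_scalar)+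
  then have "(norm (fcalc M E g x - c *\<^sub>R x))\<^sup>2 \<le> (e * norm x)\<^sup>2"
    by (simp add: measure_space_scalar_measure power_mult_distrib mult.commute)
  then show ?thesis by (rule power2_le_imp_le) (simp add: e(2))
qed

lemma norm_fcalc_diff_ge:
  assumes g: "g \<in> borel_measurable M" and x: "x \<in> dom g" and B: "B \<in> sets M" "E B x = x"
    and e: "\<And>s. s \<in> B \<Longrightarrow> e \<le> \<bar>g s - c\<bar>" "0 \<le> e"
  shows "e * norm x \<le> norm (fcalc M E g x - c *\<^sub>R x)"
proof -
  have "(\<integral>s. e\<^sup>2 \<partial>\<mu> x) \<le> (norm (fcalc M E g x - c *\<^sub>R x))\<^sup>2"
    unfolding norm_fcalc_diff [OF g x]
  proof (rule integral_mono_AE)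
    show "AE s in \<mu> x. e\<^sup>2 \<le> (g s - c)\<^sup>2"
      using AE_scalar_measure [OF B] by eventually_elim (metis e power2_abs power_mono)
  qed (intro integrable_diff_sq g x integral_const_scalar)+
  then have "(e * norm x)\<^sup>2 \<le> (norm (fcalc M E g x - c *\<^sub>R x))\<^sup>2"
    by (simp add: measure_space_scalar_measure power_mult_distrib mult.commute)
  then show ?thesis by (rule power2_le_imp_le) simp
qed

lemma inner_fcalc_mono:
  assumes g: "g \<in> borel_measurable M" "x \<in> dom g" and h: "h \<in> borel_measurable M" "x \<in> dom h"
    and B: "B \<in> sets M" "E B x = x" and le: "\<And>s. s \<in> B \<Longrightarrow> a * g s \<le> b * h s"
  shows "a * inner (fcalc M E g x) x \<le> b * inner (fcalc M E h x) x"
proof -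
  have "(\<integral>s. a * g s \<partial>\<mu> x) \<le> (\<integral>s. b * h s \<partial>\<mu> x)"
    using integrable_of_dom [OF g] integrable_of_dom [OF h] AE_scalar_measure [OF B]
    by (intro integral_mono_AE) (auto elim!: eventually_mono simp: le)
  then show ?thesis by (simp add: inner_fcalc g h)
qed

lemma inner_fcalc_ge:
  assumes g: "g \<in> borel_measurable M" "x \<in> dom g"
    and B: "B \<in> sets M" "E B x = x" and le: "\<And>s. s \<in> B \<Longrightarrow> a \<le> g s"
  shows "a * (norm x)\<^sup>2 \<le> inner (fcalc M E g x) x"
proof -
  have "(\<integral>s. a \<partial>\<mu> x) \<le> (\<integral>s. g s \<partial>\<mu> x)"
    using integrable_of_dom [OF g] integral_const_scalar AE_scalar_measure [OF B]
    by (intro integral_mono_AE) (auto elim!: eventually_mono simp: le)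
  then show ?thesis by (simp add: inner_fcalc g measure_space_scalar_measure mult.commute)
qed

lemma inner_fcalc_le:
  assumes g: "g \<in> borel_measurable M" "x \<in> dom g"
    and B: "B \<in> sets M" "E B x = x" and le: "\<And>s. s \<in> B \<Longrightarrow> g s \<le> a"
  shows "inner (fcalc M E g x) x \<le> a * (norm x)\<^sup>2"
proof -
  have "(\<integral>s. g s \<partial>\<mu> x) \<le> (\<integral>s. a \<partial>\<mu> x)"
    using integrable_of_dom [OF g] integral_const_scalar AE_scalar_measure [OF B]
    by (intro integral_mono_AE) (auto elim!: eventually_mono simp: le)
  then show ?thesis by (simp add: inner_fcalc g measure_space_scalar_measure mult.commute)
qed

end

section \<open>Monotonicity from right derivatives\<close>

text \<open>Only right derivatives exist here, so the usual mean value theorem does not apply. After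
  subtracting a slope \<open>e\<close>, the last time at which the function is still at most
  \<open>\<phi> a\<close> cannot precede \<open>b\<close>, as the right derivative there is below
  \<open>e\<close>.\<close>

lemma right_derivative_nonpos_imp_le:
  fixes \<phi> :: "real \<Rightarrow> real"
  assumes ab: "a \<le> b" and cont: "continuous_on {a..b} \<phi>"
    and deriv: "\<And>t. a \<le> t \<Longrightarrow> t < b \<Longrightarrow> (\<phi> has_real_derivative d t) (at_right t)"
    and neg: "\<And>t. a \<le> t \<Longrightarrow> t < b \<Longrightarrow> d t \<le> 0"
  shows "\<phi> b \<le> \<phi> a"
proof -
  have *: "\<phi> b - e * (b - a) \<le> \<phi> a" if e: "e > 0" for e
  proof (rule ccontr)
    assume b: "\<not> ?thesis"
    define \<psi> where "\<psi> t = \<phi> t - e * (t - a)" for t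
    \<comment> \<open>Compactness of \<open>K\<close> yields that last time as its maximum
      \<open>m\<close>.\<close>
    define K where "K = {t \<in> {a..b}. \<psi> t \<le> \<phi> a}"
    have "continuous_on {a..b} \<psi>" unfolding \<psi>_def by (intro continuous_intros cont)
    then have "closed ({a..b} \<inter> \<psi> -` {..\<phi> a})" by (rule continuous_closed_preimage) auto
    moreover have "{a..b} \<inter> \<psi> -` {..\<phi> a} = K" by (auto simp: K_def)
    ultimately have "closed K" by simp
    moreover have "bounded K" by (rule bounded_subset [of "{a..b}"]) (auto simp: K_def)
    ultimately have "compact K" by (simp add: compact_eq_bounded_closed)
    moreover have "a \<in> K" using ab by (simp add: K_def \<psi>_def)
    ultimately obtain m where m: "m \<in> K" "\<And>t. t \<in> K \<Longrightarrow> t \<le> m"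
      using compact_attains_sup [of K] by blast
    have mb: "a \<le> m" "m < b" "\<psi> m \<le> \<phi> a"
      using m(1) b by (auto simp: K_def \<psi>_def order.order_iff_strict)
    have "((\<lambda>y. (\<phi> y - \<phi> m) / (y - m)) \<longlongrightarrow> d m) (at_right m)"
      using deriv [OF mb(1,2)] by (simp add: has_field_derivative_iff)
    moreover have "d m < e" using neg [OF mb(1,2)] e by simp
    ultimately have "\<forall>\<^sub>F y in at_right m. (\<phi> y - \<phi> m) / (y - m) < e"
      by (rule order_tendstoD(2))
    moreover have "\<forall>\<^sub>F y in at_right m. y \<in> {m<..<b}"
      using mb(2) by (rule eventually_at_right_real)
    ultimately have "\<forall>\<^sub>F y in at_right m. (\<phi> y - \<phi> m) / (y - m) < e \<and> y \<in> {m<..<b}"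
      by (rule eventually_conj)
    then obtain y where y: "(\<phi> y - \<phi> m) / (y - m) < e" "m < y" "y < b"
      using eventually_happens' [OF trivial_limit_at_right_real] by auto
    then have "\<phi> y - \<phi> m < e * (y - m)" by (simp add: divide_less_eq)
    then have "y \<in> K" using y mb by (simp add: K_def \<psi>_def algebra_simps)
    with m(2) y(2) show False by fastforce
  qed
  show ?thesis
  proof (rule field_le_epsilon)
    fix e :: real assume e: "e > 0"
    \<comment> \<open>The denominator \<open>b - a + 1\<close> covers the case
      \<open>a = b\<close>.\<close>
    have "\<phi> b - (e / (b - a + 1)) * (b - a) \<le> \<phi> a" using ab e by (intro *) simp
    moreover have "(e / (b - a + 1)) * (b - a) \<le> e" using ab e by (simp add: field_simps)
    ultimately show "\<phi> b \<le> \<phi> a + e" by linarith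
  qed
qed

section \<open>The wave operator\<close>

locale wave =
  fixes D :: "'a::chilbert_space set" and A :: "'a \<Rightarrow> 'a" and E :: "real set \<Rightarrow> 'a \<Rightarrow> 'a"
    and f :: "real \<Rightarrow> real" and c :: real
  assumes selfadjoint: "selfadjoint D A"
    and c_pos: "c > 0"
    and lower_bound: "x \<in> D \<Longrightarrow> c * (norm x)\<^sup>2 \<le> Re (cinner (A x) x)"
    and spectral: "is_spectral_measure_of E D A"
    and f_cont: "continuous_on (rspectrum D A) f"
    and f_nonneg: "s \<in> rspectrum D A \<Longrightarrow> 0 \<le> f s"
begin

abbreviation \<sigma> :: "real set" where "\<sigma> \<equiv> rspectrum D A"
abbreviation M :: "real measure" where "M \<equiv> spec_space D A"

sublocale pvm M E
  using spectral by unfold_locales (simp add: is_spectral_measure_of_def)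

abbreviation X :: "('a \<times> 'a) set" where "X \<equiv> phase_space D A E"
abbreviation G :: "'a \<times> 'a \<Rightarrow> 'a \<times> 'a" where "G \<equiv> wave_op D A E f"
abbreviation domG :: "('a \<times> 'a) set" where "domG \<equiv> wave_dom D A E f"
abbreviation F :: "'a \<Rightarrow> 'a" where "F \<equiv> fcalc M E f"
abbreviation H1 :: "'a set" where "H1 \<equiv> dom (\<lambda>s. s powr (1/2))"
abbreviation R :: "'a \<Rightarrow> 'a" where "R \<equiv> fcalc M E (\<lambda>s. s powr (1/2))"
abbreviation N :: "'a \<times> 'a \<Rightarrow> real" where "N \<equiv> phase_norm D A E"

lemma space_M: "space M = \<sigma>" by (simp add: space_restrict_space)

lemma \<sigma>_ge: "s \<in> \<sigma> \<Longrightarrow> c \<le> s"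
  by (rule rspectrum_ge [OF selfadjoint lower_bound])

lemma meas_id: "(\<lambda>s. s) \<in> borel_measurable M"
  and meas_sqrt: "(\<lambda>s. s powr (1/2)) \<in> borel_measurable M"
  and meas_f: "f \<in> borel_measurable M"
  by (auto intro: measurable_restrict_space1 borel_measurable_continuous_on_restrict f_cont)

lemma D_eq: "dom (\<lambda>s. s) = D" and A_eq: "x \<in> D \<Longrightarrow> fcalc M E (\<lambda>s. s) x = A x"
  using spectral by (auto simp: is_spectral_measure_of_def)

lemmas A_lin = clinear_onD [OF selfadjointD(1) [OF selfadjoint]]
lemmas F_lin = clinear_onD [OF fcalc_clinear [OF meas_f]]
lemmas R_lin = clinear_onD [OF fcalc_clinear [OF meas_sqrt]]

lemma X_eq: "X = H1 \<times> UNIV" by (simp add: phase_space_def sobolev_space_def)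

lemma sqrt_sq: "s \<in> \<sigma> \<Longrightarrow> (s powr (1/2))\<^sup>2 = s"
  using \<sigma>_ge [of s] c_pos by (simp add: powr_half_sqrt)

lemma norm_R_sq: assumes "x \<in> H1" shows "(norm (R x))\<^sup>2 = (\<integral>s. s \<partial>\<mu> x)"
  unfolding norm_fcalc [OF meas_sqrt assms]
  by (intro Bochner_Integration.integral_cong) (auto simp: sqrt_sq space_M)

lemma D_subset_H1: "D \<subseteq> H1"
proof
  fix x assume "x \<in> D"
  then have "integrable (\<mu> x) (\<lambda>s. s)" by (intro integrable_of_dom meas_id) (simp add: D_eq)
  then show "x \<in> H1" unfolding fcalc_dom_def mem_Collect_eq
    by (subst Bochner_Integration.integrable_cong [of _ "\<mu> x" _ "\<lambda>s. s"]) (auto simp: sqrt_sq space_M)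
qed

text \<open>\<open>R\<close> is the square root of \<open>A\<close>. The identity of quadratic
  forms, read off the same scalar measure, is polarized over the reals using the symmetry of
  \<open>A\<close>.\<close>

lemma R_A: assumes x: "x \<in> D" and y: "y \<in> D" shows "inner (R x) (R y) = inner (A x) y"
proof -
  have q: "inner (R x) (R x) = inner (A x) x" if x: "x \<in> D" for x
    using norm_R_sq [of x] inner_fcalc [OF meas_id, of x] D_subset_H1 x
    by (auto simp: A_eq D_eq power2_norm_eq_inner)
  have sym: "inner (A y) x = inner (A x) y"
    using selfadjointD(3) [OF selfadjoint y x] by (metis Re_cinner inner_commute)
  have "x \<in> H1" "y \<in> H1" "x + y \<in> D" using x y D_subset_H1 A_lin(2) by auto
  then show ?thesis
    using q [OF x] q [OF y] q [of "x + y"] x y sym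
    by (simp add: A_lin R_lin inner_add_left inner_add_right inner_commute)
qed

lemma R_lower_bound:
  assumes x: "x \<in> H1" and B: "B \<in> sets M" "E B x = x" and b: "\<And>s. s \<in> B \<Longrightarrow> b \<le> s" "b > 0"
  shows "sqrt b * norm x \<le> norm (R x)"
  using norm_fcalc_diff_ge [OF meas_sqrt x B, of "sqrt b" 0] b
  by (force simp: powr_half_sqrt)

lemma R_ge: "x \<in> H1 \<Longrightarrow> sqrt c * norm x \<le> norm (R x)"
  by (rule R_lower_bound [of _ \<sigma>]) (use \<sigma>_ge c_pos E_space sets.top [of M] in \<open>auto simp: space_M\<close>)

text \<open>An isometry of the phase space with norm \<open>N\<close> into the product type: energy
  computations take place in the ambient inner product.\<close>

definition J :: "'a \<times> 'a \<Rightarrow> 'a \<times> 'a" where "J z = (R (fst z), snd z)"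

lemma N_eq: "N z = norm (J z)"
  by (simp add: phase_norm_def sobolev_norm_def J_def norm_prod_def split_beta)

lemma clinear_J: "clinear_on X J"
  unfolding clinear_on_def csubspace_def X_eq
  by (auto simp: J_def R_lin scaleC_prod_def zero_prod_def)

lemmas J_lin = clinear_onD [OF clinear_J]

lemma fst_bound: assumes "z \<in> X" shows "norm (fst z) \<le> (1 / sqrt c) * norm (J z)"
proof -
  have "sqrt c * norm (fst z) \<le> norm (R (fst z))" using assms by (intro R_ge) (auto simp: X_eq)
  also have "\<dots> \<le> norm (J z)" using norm_fst_le by (simp add: J_def)
  finally show ?thesis using c_pos by (simp add: field_simps)
qed

lemma snd_bound: "norm (snd z) \<le> norm (J z)"
  using norm_snd_le by (simp add: J_def)

lemma J_eq_0: assumes "z \<in> X" "J z = 0" shows "z = 0"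
  using fst_bound [OF assms(1)] snd_bound [of z] assms(2) by (simp add: prod_eq_iff)

section \<open>Spectral truncation in the phase space\<close>

definition P :: "real set \<Rightarrow> 'a \<times> 'a \<Rightarrow> 'a \<times> 'a" where "P B z = (E B (fst z), E B (snd z))"

lemma P_in_X: "B \<in> sets M \<Longrightarrow> z \<in> X \<Longrightarrow> P B z \<in> X"
  by (auto simp: P_def X_eq E_in_dom meas_sqrt)

lemma J_P: "B \<in> sets M \<Longrightarrow> z \<in> X \<Longrightarrow> J (P B z) = P B (J z)"
  by (auto simp: P_def X_eq J_def fcalc_E meas_sqrt)

lemma norm_P_le: "B \<in> sets M \<Longrightarrow> norm (P B z) \<le> norm z"
  unfolding P_def norm_prod_def by (auto intro!: real_sqrt_le_mono add_mono power_mono E_norm_le)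

lemma P_diff: "B \<in> sets M \<Longrightarrow> P B (z - w) = P B z - P B w"
  and P_scaleR: "B \<in> sets M \<Longrightarrow> P B (r *\<^sub>R z) = r *\<^sub>R P B z"
  by (simp_all add: P_def E_diff E_scaleR)

lemma P_Compl: "B \<in> sets M \<Longrightarrow> P (\<sigma> - B) z = z - P B z"
  using E_Compl by (simp add: P_def space_M prod_eq_iff)

text \<open>Density of the test space is what makes the value of the duality sum unique. Truncating
  by \<open>\<bar>s\<bar> + \<bar>f s\<bar>\<close> controls both domains with a single
  sequence.\<close>

lemma test_dense: "closure (D \<inter> dom f) = UNIV"
proof -
  let ?g = "\<lambda>s. \<bar>s\<bar> + \<bar>f s\<bar>"
  let ?B = "\<lambda>n. {s \<in> space M. \<bar>?g s\<bar> \<le> real n}"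
  have g: "?g \<in> borel_measurable M" using meas_id meas_f by measurable
  have "x \<in> closure (D \<inter> dom f)" for x
    unfolding closure_sequential
  proof (intro exI conjI allI)
    show "(\<lambda>n. E (?B n) x) \<longlonglongrightarrow> x" by (rule truncation_tendsto [OF g])
    fix n
    have B: "?B n \<in> sets M" using g by measurable
    have "E (?B n) x \<in> dom (\<lambda>s. s)"
      by (rule dom_bounded [OF meas_id B E_idem [OF B], of n]) auto
    moreover have "E (?B n) x \<in> dom f"
      by (rule dom_bounded [OF meas_f B E_idem [OF B], of n]) auto
    ultimately show "E (?B n) x \<in> D \<inter> dom f" by (simp add: D_eq)
  qed
  then show ?thesis by blast
qed

lemma weak_sum_unique:
  assumes "is_weak_sum D A E f u v h" "is_weak_sum D A E f u v h'"
  shows "h = h'"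
  by (rule eq_of_cinner_dense [OF test_dense]) (use assms in \<open>simp add: is_weak_sum_def\<close>)

lemma G_eq: "is_weak_sum D A E f u v h \<Longrightarrow> G (u, v) = (v, - h)"
  using weak_sum_unique unfolding wave_op_def by (auto intro!: the_equality)

lemma domG_iff: "(u, v) \<in> domG \<longleftrightarrow> u \<in> H1 \<and> v \<in> H1 \<and> (\<exists>h. is_weak_sum D A E f u v h)"
  by (simp add: wave_dom_def X_eq sobolev_space_def)

lemma weak_sum_strong:
  assumes u: "u \<in> D" and v: "v \<in> dom f"
  shows "is_weak_sum D A E f u v (A u + F v)"
  unfolding is_weak_sum_def
  by (auto simp: cinner_add_right selfadjointD(3) [OF selfadjoint _ u] fcalc_sym [OF meas_f _ v])

lemma A_E: "B \<in> sets M \<Longrightarrow> x \<in> D \<Longrightarrow> E B x \<in> D \<and> A (E B x) = E B (A x)"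
  using E_in_dom [OF meas_id, of B x] fcalc_E [OF meas_id, of B x] by (simp add: D_eq A_eq)

text \<open>\<open>E B\<close> preserves the test space and commutes with \<open>A\<close> and
  \<open>F\<close> there, so it can be moved onto the test vector.\<close>

lemma weak_sum_E:
  assumes B: "B \<in> sets M" and h: "is_weak_sum D A E f u v h"
  shows "is_weak_sum D A E f (E B u) (E B v) (E B h)"
  unfolding is_weak_sum_def
proof
  fix w assume w: "w \<in> D \<inter> dom f"
  then have "E B w \<in> D \<inter> dom f" using A_E [OF B] E_in_dom [OF meas_f B] by blast
  then have "cinner (A (E B w)) u + cinner (F (E B w)) v = cinner (E B w) h"
    using h by (simp add: is_weak_sum_def)
  then show "cinner (A w) (E B u) + cinner (F w) (E B v) = cinner w (E B h)"
    using w A_E [OF B, of w] fcalc_E [OF meas_f B, of w] by (simp add: E_sym [OF B])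
qed

lemma domG_P:
  assumes B: "B \<in> sets M" and z: "z \<in> domG"
  shows "P B z \<in> domG" and "G (P B z) = P B (G z)"
proof -
  obtain u v where uv: "z = (u, v)" by (cases z)
  then obtain h where h: "u \<in> H1" "v \<in> H1" "is_weak_sum D A E f u v h" using z domG_iff by blast
  note h' = weak_sum_E [OF B h(3)]
  show "P B z \<in> domG" unfolding uv P_def fst_conv snd_conv domG_iff
    using h' h E_in_dom [OF meas_sqrt B] by blast
  show "G (P B z) = P B (G z)"
    unfolding uv P_def fst_conv snd_conv G_eq [OF h'] G_eq [OF h(3)] by (simp add: E_minus B)
qed

text \<open>On the range of \<open>P B\<close> for such sets \<open>B\<close> all operators are bounded.\<close>

definition tame :: "real set \<Rightarrow> bool" where
  "tame B \<longleftrightarrow> B \<in> sets M \<and> (\<exists>n. \<forall>s\<in>B. s \<le> n \<and> f s \<le> n)"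

lemma tameD:
  assumes "tame B" and x: "E B x = x"
  shows "x \<in> D" "x \<in> dom f" "x \<in> H1"
proof -
  from assms obtain n where B: "B \<in> sets M" and n: "\<And>s. s \<in> B \<Longrightarrow> s \<le> n \<and> f s \<le> n"
    by (auto simp: tame_def)
  have s: "s \<in> \<sigma>" if "s \<in> B" for s using sets.sets_into_space [OF B] that by (auto simp: space_M)
  have "x \<in> dom (\<lambda>s. s)"
    by (rule dom_bounded [OF meas_id B x, of n]) (use n \<sigma>_ge s c_pos in force)
  then show "x \<in> D" by (simp add: D_eq)
  then show "x \<in> H1" using D_subset_H1 by blast
  show "x \<in> dom f"
    by (rule dom_bounded [OF meas_f B x, of n]) (use n f_nonneg s in force)
qed

lemma tame_Int: "tame B \<Longrightarrow> C \<in> sets M \<Longrightarrow> tame (B \<inter> C)"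
  by (auto simp: tame_def)

lemma tame_domG:
  assumes "tame B" "P B z = z"
  shows "z \<in> domG" "G z = (snd z, - (A (fst z) + F (snd z)))"
    "fst z \<in> D" "snd z \<in> D" "snd z \<in> dom f" "fst z \<in> dom f" "z \<in> X" "G z \<in> X"
proof -
  have "E B (fst z) = fst z" "E B (snd z) = snd z" using assms(2) by (auto simp: P_def prod_eq_iff)
  note d = tameD [OF assms(1) this(1)] tameD [OF assms(1) this(2)]
  note w = weak_sum_strong [OF d(1,5)]
  have "(fst z, snd z) \<in> domG" unfolding domG_iff using d w by blast
  then show "z \<in> domG" by simp
  show g: "G z = (snd z, - (A (fst z) + F (snd z)))" using G_eq [OF w] by simp
  show "fst z \<in> D" "snd z \<in> D" "snd z \<in> dom f" "fst z \<in> dom f" using d by auto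
  show "z \<in> X" "G z \<in> X" using d g by (auto simp: X_eq mem_Times_iff)
qed

text \<open>The terms pairing \<open>A u\<close> with \<open>v\<close> cancel by \<open>R_A\<close>;
  only the damping remains.\<close>

lemma energy_form:
  assumes "tame B" "P B z = z"
  shows "inner (J z) (J (G z)) = - inner (F (snd z)) (snd z)"
proof -
  note d = tame_domG [OF assms]
  show ?thesis unfolding d(2)
    by (simp add: J_def inner_add_right R_A d inner_diff_right inner_commute)
qed

end

section \<open>The semigroup on spectral subspaces\<close>

locale wave_semigroup = wave D A E f c
  for D :: "'a::chilbert_space set" and A E f c +
  fixes S :: "real \<Rightarrow> 'a \<times> 'a \<Rightarrow> 'a \<times> 'a"
  assumes semigroup: "contraction_semigroup X N S"
    and generator: "generated_by X N S domG G"
begin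

lemma S_X: "0 \<le> t \<Longrightarrow> z \<in> X \<Longrightarrow> S t z \<in> X"
  and S_clinear: "0 \<le> t \<Longrightarrow> clinear_on X (S t)"
  and S_0: "z \<in> X \<Longrightarrow> S 0 z = z"
  and S_add: "0 \<le> s \<Longrightarrow> 0 \<le> t \<Longrightarrow> z \<in> X \<Longrightarrow> S (s + t) z = S s (S t z)"
  and S_tendsto: "z \<in> X \<Longrightarrow> ((\<lambda>t. norm (J (S t z - z))) \<longlongrightarrow> 0) (at_right 0)"
  and S_contr: "0 \<le> t \<Longrightarrow> z \<in> X \<Longrightarrow> norm (J (S t z)) \<le> norm (J z)"
  using semigroup unfolding contraction_semigroup_def N_eq by blast+

lemmas S_lin = clinear_onD [OF S_clinear]

lemma domGD:
  assumes "z \<in> domG"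
  shows "z \<in> X" "G z \<in> X"
    "((\<lambda>t. norm (J ((S t z - z) /\<^sub>R t - G z))) \<longlongrightarrow> 0) (at_right 0)"
proof -
  have "(z, G z) \<in> generator_graph X N S"
    using generator assms unfolding generated_by_def by blast
  then show "z \<in> X" "G z \<in> X"
    "((\<lambda>t. norm (J ((S t z - z) /\<^sub>R t - G z))) \<longlongrightarrow> 0) (at_right 0)"
    by (simp_all add: generator_graph_def N_eq)
qed

lemma domGI:
  assumes "z \<in> X" "w \<in> X"
    "((\<lambda>t. norm (J ((S t z - z) /\<^sub>R t - w))) \<longlongrightarrow> 0) (at_right 0)"
  shows "z \<in> domG \<and> G z = w"
proof -
  have "(z, w) \<in> generator_graph X N S" using assms by (simp add: generator_graph_def N_eq)
  then show ?thesis using generator unfolding generated_by_def by auto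
qed

text \<open>\<open>S t\<close> commutes with the difference quotients at 0 and is a contraction, so
  their convergence is inherited.\<close>

lemma S_domG:
  assumes z: "z \<in> domG" and t: "0 \<le> t"
  shows "S t z \<in> domG" and "G (S t z) = S t (G z)"
proof -
  note zX = domGD(1,2) [OF z]
  have "((\<lambda>h. norm (J ((S h (S t z) - S t z) /\<^sub>R h - S t (G z)))) \<longlongrightarrow> 0) (at_right 0)"
  proof (rule Lim_null_comparison [OF _ domGD(3) [OF z]])
    have "norm (J ((S h (S t z) - S t z) /\<^sub>R h - S t (G z))) \<le> norm (J ((S h z - z) /\<^sub>R h - G z))"
      if h: "h > 0" for h
    proof -
      have "S h (S t z) = S t (S h z)"
        using S_add [of h t z] S_add [of t h z] h t zX by (simp add: add.commute)
      moreover have "S h z \<in> X" using h zX by (intro S_X) auto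
      ultimately have "(S h (S t z) - S t z) /\<^sub>R h - S t (G z) = S t ((S h z - z) /\<^sub>R h - G z)"
        and "(S h z - z) /\<^sub>R h - G z \<in> X"
        using zX t S_lin by auto
      then show ?thesis using S_contr [OF t] by simp
    qed
    then show "\<forall>\<^sub>F h in at_right 0. norm (norm (J ((S h (S t z) - S t z) /\<^sub>R h - S t (G z))))
        \<le> norm (J ((S h z - z) /\<^sub>R h - G z))"
      by (intro eventually_at_rightI [of 0 1]) auto
  qed
  then have "S t z \<in> domG \<and> G (S t z) = S t (G z)" using zX t S_X by (intro domGI) auto
  then show "S t z \<in> domG" and "G (S t z) = S t (G z)" by auto
qed

section \<open>Trajectories seen through bounded linear maps\<close>

definition phase_bounded :: "('a \<times> 'a \<Rightarrow> 'b::real_normed_vector) \<Rightarrow> bool" where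
  "phase_bounded T \<longleftrightarrow> (\<forall>z\<in>X. \<forall>w\<in>X. T (z - w) = T z - T w) \<and>
    (\<forall>r. \<forall>z\<in>X. T (r *\<^sub>R z) = r *\<^sub>R T z) \<and> (\<exists>K\<ge>0. \<forall>z\<in>X. norm (T z) \<le> K * norm (J z))"

lemma phase_boundedI:
  assumes "\<And>z w. z \<in> X \<Longrightarrow> w \<in> X \<Longrightarrow> T (z - w) = T z - T w"
    and "\<And>r z. z \<in> X \<Longrightarrow> T (r *\<^sub>R z) = r *\<^sub>R T z"
    and "\<And>z. z \<in> X \<Longrightarrow> norm (T z) \<le> K * norm (J z)" and "0 \<le> K"
  shows "phase_bounded T"
  using assms unfolding phase_bounded_def by blast

text \<open>By the semigroup law the increment after time \<open>t\<close> starts afresh from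
  \<open>S t z\<close>, which is in the domain; boundedness of \<open>T\<close> relative to the
  phase norm transfers the limit defining the generator.\<close>

lemma right_derivative:
  assumes T: "phase_bounded T" and z: "z \<in> domG" and t: "0 \<le> t"
  shows "((\<lambda>s. T (S s z)) has_vector_derivative T (G (S t z))) (at_right t)"
proof -
  obtain K where T: "\<And>z w. z \<in> X \<Longrightarrow> w \<in> X \<Longrightarrow> T (z - w) = T z - T w"
    "\<And>r z. z \<in> X \<Longrightarrow> T (r *\<^sub>R z) = r *\<^sub>R T z" and K: "\<And>z. z \<in> X \<Longrightarrow> norm (T z) \<le> K * norm (J z)"
    using T unfolding phase_bounded_def by blast
  define y where "y = S t z"
  have y: "y \<in> domG" unfolding y_def by (rule S_domG [OF z t])
  note yX = domGD(1,2) [OF y]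
  have "((\<lambda>h. (1 / norm h) *\<^sub>R (T (S (h + t) z) - (T y + h *\<^sub>R T (G y)))) \<longlongrightarrow> 0) (at_right 0)"
  proof (rule Lim_null_comparison)
    show "((\<lambda>h. K * norm (J ((S h y - y) /\<^sub>R h - G y))) \<longlongrightarrow> 0) (at_right 0)"
      using tendsto_mult_right_zero [OF domGD(3) [OF y]] .
    have "norm ((1 / norm h) *\<^sub>R (T (S (h + t) z) - (T y + h *\<^sub>R T (G y))))
      \<le> K * norm (J ((S h y - y) /\<^sub>R h - G y))" if h: "h > 0" for h
    proof -
      have Sy: "S (h + t) z = S h y" "S h y \<in> X"
        using S_add [of h t z] S_X [of h y] h t domGD(1) [OF z] yX by (auto simp: y_def)
      then have X: "(S h y - y) /\<^sub>R h \<in> X" "S h y - y \<in> X" using yX J_lin(4,6) by auto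
      have "T ((S h y - y) /\<^sub>R h - G y) = (T (S h y) - T y) /\<^sub>R h - T (G y)"
        by (simp only: T(1) [OF X(1) yX(2)] T(2) [OF X(2)] T(1) [OF Sy(2) yX(1)])
      then have "(1 / norm h) *\<^sub>R (T (S h y) - (T y + h *\<^sub>R T (G y))) = T ((S h y - y) /\<^sub>R h - G y)"
        using h by (simp add: scaleR_diff_right scaleR_add_right inverse_eq_divide)
      then show ?thesis using K [of "(S h y - y) /\<^sub>R h - G y"] X yX J_lin(6) by (simp add: Sy)
    qed
    then show "\<forall>\<^sub>F h in at_right 0. norm ((1 / norm h) *\<^sub>R (T (S (h + t) z) - (T y + h *\<^sub>R T (G y))))
      \<le> K * norm (J ((S h y - y) /\<^sub>R h - G y))"
      by (intro eventually_at_rightI [of 0 1]) auto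
  qed
  then have "((\<lambda>s. (1 / norm (s - t)) *\<^sub>R (T (S s z) - (T (S t z) + (s - t) *\<^sub>R T (G (S t z))))) \<longlongrightarrow> 0) (at_right t)"
    by (subst filterlim_at_right_to_0) (simp add: y_def)
  then show ?thesis
    unfolding has_vector_derivative_def has_derivative_within
    by (simp add: bounded_linear_scaleR_left)
qed

text \<open>Contractivity bounds the increment between \<open>t \<le> s\<close> by the increment
  between 0 and \<open>s - t\<close>, so right continuity at 0 gives continuity from both
  sides.\<close>

lemma trajectory_continuous:
  assumes T: "phase_bounded T" and z: "z \<in> X"
  shows "continuous_on {0..} (\<lambda>t. T (S t z))"
proof -
  obtain K where T: "\<And>z w. z \<in> X \<Longrightarrow> w \<in> X \<Longrightarrow> T (z - w) = T z - T w"
    and K: "\<And>z. z \<in> X \<Longrightarrow> norm (T z) \<le> K * norm (J z)" "K \<ge> 0"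
    using T unfolding phase_bounded_def by blast
  have *: "norm (T (S s z) - T (S t z)) \<le> K * norm (J (S (s - t) z - z))" if "0 \<le> t" "t \<le> s" for s t
  proof -
    have X: "S s z \<in> X" "S t z \<in> X" "S (s - t) z \<in> X" using that z by (auto intro: S_X)
    have "norm (T (S s z) - T (S t z)) \<le> K * norm (J (S s z - S t z))"
      using K(1) [of "S s z - S t z"] J_lin(6) X T by simp
    also have "S s z - S t z = S t (S (s - t) z - z)"
      using S_add [of t "s - t" z] S_lin(11) [of t "S (s - t) z" z] that z X by simp
    also have "K * norm (J (S t (S (s - t) z - z))) \<le> K * norm (J (S (s - t) z - z))"
      using that z X J_lin(6) K(2) by (intro mult_left_mono S_contr) auto
    finally show ?thesis .
  qed
  show ?thesis
    unfolding continuous_on_iff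
  proof (intro ballI allI impI)
    fix t e :: real assume t: "t \<in> {0..}" and e: "e > 0"
    have "((\<lambda>h. K * norm (J (S h z - z))) \<longlongrightarrow> 0) (at_right 0)"
      using tendsto_mult_right_zero [OF S_tendsto [OF z]] .
    then have "\<forall>\<^sub>F h in at_right 0. K * norm (J (S h z - z)) < e"
      using e by (rule order_tendstoD(2))
    then obtain d where d: "d > 0" "\<And>h. 0 < h \<Longrightarrow> h < d \<Longrightarrow> K * norm (J (S h z - z)) < e"
      by (auto simp: eventually_at_right_field)
    have "dist (T (S s z)) (T (S t z)) < e" if s: "s \<in> {0..}" "dist s t < d" for s
    proof -
      consider "s = t" | "s < t" | "t < s" by linarith
      then show ?thesis
      proof cases
        case 2
        then show ?thesis using * [of s t] d(2) [of "t - s"] s t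
          by (force simp: dist_norm norm_minus_commute)
      next
        case 3
        then show ?thesis using * [of t s] d(2) [of "s - t"] s t
          by (force simp: dist_norm)
      qed (use e in auto)
    qed
    then show "\<exists>d>0. \<forall>s\<in>{0..}. dist s t < d \<longrightarrow> dist (T (S s z)) (T (S t z)) < e"
      using d(1) by blast
  qed
qed

lemma phase_bounded_J: "phase_bounded J"
  by (rule phase_boundedI [of _ 1]) (auto simp: J_lin)

lemma phase_bounded_fst: "phase_bounded fst"
  by (rule phase_boundedI [of _ "1 / sqrt c"]) (use c_pos in \<open>auto intro: fst_bound [simplified]\<close>)

lemma phase_bounded_snd: "phase_bounded snd"
  by (rule phase_boundedI [of _ 1]) (auto simp: snd_bound)

lemma phase_bounded_JP: "B \<in> sets M \<Longrightarrow> phase_bounded (\<lambda>z. J (P B z))"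
  by (rule phase_boundedI [of _ 1]) (auto simp: J_lin P_diff P_scaleR P_in_X J_P norm_P_le)

lemma inner_right_derivative:
  assumes "(g has_vector_derivative g') F'" "(h has_vector_derivative h') F'" "F' = at t within I"
  shows "((\<lambda>s. inner (g s) (h s)) has_real_derivative inner (g t) h' + inner g' (h t)) F'"
  using bounded_bilinear.has_vector_derivative [OF bounded_bilinear_inner, of g g' t I h h'] assms
  by (simp add: has_real_derivative_iff_has_vector_derivative)

text \<open>Obtained by differentiating the nonincreasing norm at 0, so it holds on the whole
  domain, beyond the tame data of \<open>energy_form\<close>. This matters for the component in a
  complementary spectral subspace, where the operators may be unbounded.\<close>

lemma dissipative:
  assumes z: "z \<in> domG"
  shows "inner (J z) (J (G z)) \<le> 0"
proof -
  note zX = domGD(1) [OF z]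
  let ?\<phi> = "\<lambda>t. inner (J (S t z)) (J (S t z))"
  have "(?\<phi> has_real_derivative 2 * inner (J z) (J (G z))) (at_right 0)"
    using inner_right_derivative [OF right_derivative right_derivative refl,
        OF phase_bounded_J z order_refl phase_bounded_J z order_refl]
    by (simp add: S_0 zX inner_commute)
  then have "((\<lambda>t. (?\<phi> t - ?\<phi> 0) / (t - 0)) \<longlongrightarrow> 2 * inner (J z) (J (G z))) (at_right 0)"
    by (simp add: has_field_derivative_iff)
  moreover have "(?\<phi> t - ?\<phi> 0) / (t - 0) \<le> 0" if "t > 0" for t
    using S_contr [of t z] that zX
    by (simp add: divide_le_0_iff S_0 power_mono flip: power2_norm_eq_inner)
  then have "\<forall>\<^sub>F t in at_right 0. (?\<phi> t - ?\<phi> 0) / (t - 0) \<le> 0"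
    by (intro eventually_at_rightI [of 0 1]) auto
  ultimately have "2 * inner (J z) (J (G z)) \<le> 0"
    by (intro tendsto_upperbound) auto
  then show ?thesis by simp
qed

text \<open>The component of a trajectory in the complementary spectral subspace vanishes initially and
  has nonincreasing norm, as it solves the same dissipative equation.\<close>

lemma spectral_subspace_invariant:
  assumes B: "B \<in> sets M" and z: "z \<in> domG" "P B z = z" and t: "0 \<le> t"
  shows "P B (S t z) = S t z"
proof -
  let ?C = "\<sigma> - B"
  have C: "?C \<in> sets M" using sets.compl_sets [OF B] by (simp add: space_M)
  let ?q = "\<lambda>s. J (P ?C (S s z))"
  note zX = domGD(1) [OF z(1)]
  have SX: "S t z \<in> X" using S_X [OF t zX] .
  have PX: "P ?C (S t z) \<in> X" by (rule P_in_X [OF C SX])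
  have "inner (?q t) (?q t) \<le> inner (?q 0) (?q 0)"
  proof (rule right_derivative_nonpos_imp_le [OF t])
    have "continuous_on {0..t} ?q"
      using continuous_on_subset [OF trajectory_continuous [OF phase_bounded_JP [OF C] zX], of "{0..t}"] by auto
    then show "continuous_on {0..t} (\<lambda>s. inner (?q s) (?q s))" by (intro continuous_intros)
    fix s assume s: "0 \<le> s" "s < t"
    show "((\<lambda>s. inner (?q s) (?q s)) has_real_derivative
      inner (?q s) (J (P ?C (G (S s z)))) + inner (J (P ?C (G (S s z)))) (?q s)) (at_right s)"
      by (intro inner_right_derivative [OF _ _ refl] right_derivative [OF phase_bounded_JP [OF C] z(1) s(1)])
    have "S s z \<in> domG" by (rule S_domG [OF z(1) s(1)])
    then show "inner (?q s) (J (P ?C (G (S s z)))) + inner (J (P ?C (G (S s z)))) (?q s) \<le> 0"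
      using dissipative [of "P ?C (S s z)"] domG_P [OF C] by (simp add: inner_commute)
  qed
  also have "?q 0 = 0" using z(2) by (simp add: S_0 zX P_Compl [OF B] J_lin)
  finally have "?q t = 0" by (metis inner_gt_zero_iff inner_zero_left not_less)
  then have "P ?C (S t z) = 0" using J_eq_0 PX by blast
  then show ?thesis by (simp add: P_Compl [OF B])
qed

end

section \<open>Energy estimates\<close>

context wave_semigroup
begin

lemma tame_trajectory:
  assumes "tame B" "P B z = z" "0 \<le> t"
  shows "P B (S t z) = S t z"
  using spectral_subspace_invariant [OF _ tame_domG(1) [OF assms(1,2)] assms(2,3)] assms(1)
  by (simp add: tame_def)

text \<open>Inserting \<open>E B\<close> makes \<open>F\<close> everywhere defined and bounded. On
  trajectories in the range of \<open>P B\<close> it acts as the identity, so \<open>F u\<close> can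
  be differentiated in time.\<close>

lemma phase_bounded_F:
  assumes B: "tame B"
  shows "phase_bounded (\<lambda>z. F (E B (fst z)))"
proof -
  obtain n where BM: "B \<in> sets M" and n: "\<And>s. s \<in> B \<Longrightarrow> f s \<le> n"
    using B by (auto simp: tame_def)
  have d: "E B x \<in> dom f" for x using tameD(2) [OF B] E_idem [OF BM] by blast
  have bd: "\<bar>f s - 0\<bar> \<le> \<bar>n\<bar>" if "s \<in> B" for s
    using n [OF that] f_nonneg [of s] sets.sets_into_space [OF BM] that by (force simp: space_M)
  show ?thesis
  proof (rule phase_boundedI [of _ "\<bar>n\<bar> * (1 / sqrt c)"])
    fix z :: "'a \<times> 'a" assume z: "z \<in> X"
    have "norm (F (E B (fst z))) \<le> \<bar>n\<bar> * norm (E B (fst z))"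
      using norm_fcalc_diff_le [OF meas_f d BM E_idem [OF BM] bd] by simp
    also have "\<dots> \<le> \<bar>n\<bar> * ((1 / sqrt c) * norm (J z))"
      by (intro mult_left_mono order_trans [OF E_norm_le [OF BM] fst_bound [OF z]]) auto
    finally show "norm (F (E B (fst z))) \<le> \<bar>n\<bar> * (1 / sqrt c) * norm (J z)" by (simp add: mult.assoc)
  qed (use c_pos d in \<open>auto simp: E_diff BM E_scaleR F_lin\<close>)
qed

lemma energy_right_derivative:
  assumes B: "tame B" "P B z = z" and t: "0 \<le> t"
  shows "((\<lambda>s. (norm (J (S s z)))\<^sup>2) has_real_derivative
    - 2 * inner (F (snd (S t z))) (snd (S t z))) (at_right t)"
proof -
  have "((\<lambda>s. (norm (J (S s z)))\<^sup>2) has_real_derivative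
    inner (J (S t z)) (J (G (S t z))) + inner (J (G (S t z))) (J (S t z))) (at_right t)"
    unfolding power2_norm_eq_inner
    by (intro inner_right_derivative [OF _ _ refl] right_derivative [OF phase_bounded_J tame_domG(1) [OF B] t])
  then show ?thesis
    using energy_form [OF B(1) tame_trajectory [OF B t]] by (simp add: inner_commute)
qed

lemma energy_continuous:
  assumes "z \<in> X" shows "continuous_on {0..t} (\<lambda>s. (norm (J (S s z)))\<^sup>2)"
  using continuous_on_subset [OF trajectory_continuous [OF phase_bounded_J assms], of "{0..t}"]
  by (intro continuous_intros) auto

text \<open>The dissipation rate is at most \<open>2 * e\<close> times the current energy, hence at
  most \<open>2 * e\<close> times the initial one; a linear loss results.\<close>

lemma energy_lower_bound:
  assumes B: "tame B" "P B z = z" and t: "0 \<le> t" and e: "\<And>s. s \<in> B \<Longrightarrow> f s \<le> e" "0 \<le> e"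
  shows "(1 - 2 * e * t) * (norm (J z))\<^sup>2 \<le> (norm (J (S t z)))\<^sup>2"
proof -
  have zX: "z \<in> X" and BM: "B \<in> sets M" using B tame_domG(7) by (auto simp: tame_def)
  let ?e0 = "(norm (J z))\<^sup>2"
  let ?\<phi> = "\<lambda>s. - (norm (J (S s z)))\<^sup>2 - 2 * e * s * ?e0"
  have "?\<phi> t \<le> ?\<phi> 0"
  proof (rule right_derivative_nonpos_imp_le [OF t])
    show "continuous_on {0..t} ?\<phi>" by (intro continuous_intros energy_continuous zX)
    fix s assume s: "0 \<le> s" "s < t"
    let ?v = "snd (S s z)"
    show "(?\<phi> has_real_derivative 2 * inner (F ?v) ?v - 2 * e * ?e0) (at_right s)"
    proof -
      have "((\<lambda>s. 2 * e * s * ?e0) has_real_derivative 2 * e * ?e0) (at_right s)"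
        by (auto intro!: derivative_eq_intros)
      from DERIV_diff [OF DERIV_minus [OF energy_right_derivative [OF B s(1)]] this]
      show ?thesis by (rule DERIV_cong) simp
    qed
    note y = tame_domG [OF B(1) tame_trajectory [OF B s(1)]]
    have "E B ?v = ?v" using tame_trajectory [OF B s(1)] by (auto simp: P_def prod_eq_iff)
    then have "inner (F ?v) ?v \<le> e * (norm ?v)\<^sup>2" by (intro inner_fcalc_le [OF meas_f _ BM] y e)
    also have "\<dots> \<le> e * ?e0"
      using order_trans [OF snd_bound S_contr [OF s(1) zX]] e(2)
      by (intro mult_left_mono power_mono) auto
    finally show "2 * inner (F ?v) ?v - 2 * e * ?e0 \<le> 0" by simp
  qed
  then show ?thesis by (simp add: S_0 zX algebra_simps)
qed

text \<open>The Lyapunov function is the energy plus a multiple of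
  \<open>2 Re \<langle>u, v\<rangle> + \<langle>f(A) u, u\<rangle>\<close>; the last term cancels the mixed term in \<open>u\<close> and \<open>f(A) v\<close> arising
  from the derivative of \<open>Re \<langle>u, v\<rangle>\<close>. Adding \<open>2 d t\<close> times the energy, which is nonincreasing,
  preserves monotonicity and yields a decay rate without any differential inequality.\<close>

lemma energy_decay:
  assumes B: "tame B" "P B z = z" and t: "0 \<le> t"
    and e: "\<And>s. s \<in> B \<Longrightarrow> e \<le> f s" and C: "\<And>s. s \<in> B \<Longrightarrow> f s \<le> C * s"
    and d: "0 < d" "2 * d \<le> e" "2 * d \<le> sqrt c"
  shows "2 * d * t * (norm (J (S t z)))\<^sup>2 \<le> (3 / 2 + d * C) * (norm (J z))\<^sup>2"
proof -
  have zX: "z \<in> X" and zG: "z \<in> domG" and BM: "B \<in> sets M"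
    using B tame_domG by (auto simp: tame_def)
  define u where "u s = fst (S s z)" for s
  define v where "v s = snd (S s z)" for s
  let ?E = "\<lambda>s. (norm (J (S s z)))\<^sup>2"
  let ?V = "\<lambda>s. ?E s + 2 * d * inner (u s) (v s) + d * inner (F (E B (u s))) (u s)"
  let ?W = "\<lambda>s. ?V s + 2 * d * s * ?E s"
  have traj: "E B (u s) = u s" "E B (v s) = v s" "u s \<in> D" "v s \<in> D" "u s \<in> dom f" "v s \<in> dom f"
    "u s \<in> H1" "G (S s z) = (v s, - (A (u s) + F (v s)))" if "0 \<le> s" for s
    using tame_trajectory [OF B that] tame_domG [OF B(1) tame_trajectory [OF B that]] D_subset_H1
    by (auto simp: u_def v_def P_def prod_eq_iff)
  have E_eq: "?E s = (norm (R (u s)))\<^sup>2 + (norm (v s))\<^sup>2" for s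
    by (simp add: J_def u_def v_def norm_prod_def)
  have Fv: "e * (norm (v s))\<^sup>2 \<le> inner (F (v s)) (v s)" if "0 \<le> s" for s
    using traj [OF that] by (intro inner_fcalc_ge [OF meas_f _ BM] e)
  \<comment> \<open>By \<open>2 * d \<le> sqrt c\<close> the mixed term is at most half the energy.
    This gives \<open>0 \<le> ?V t\<close> and the constant \<open>3 / 2\<close> at time 0.\<close>
  have uv: "2 * d * \<bar>inner (u s) (v s)\<bar> \<le> ?E s / 2" if "0 \<le> s" for s
  proof -
    have "2 * d * \<bar>inner (u s) (v s)\<bar> \<le> 2 * d * (norm (u s) * norm (v s))"
      using d by (intro mult_left_mono Cauchy_Schwarz_ineq2) auto
    also have "\<dots> = (2 * d * norm (u s)) * norm (v s)" by simp
    also have "2 * d * norm (u s) \<le> sqrt c * norm (u s)" using d by (intro mult_right_mono) auto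
    also have "\<dots> \<le> norm (R (u s))" by (rule R_ge [OF traj(7) [OF that]])
    finally have "2 * d * \<bar>inner (u s) (v s)\<bar> \<le> norm (R (u s)) * norm (v s)" by (simp add: mult_right_mono)
    also have "\<dots> \<le> ?E s / 2"
      using zero_le_power2 [of "norm (R (u s)) - norm (v s)"] unfolding E_eq
      by (simp add: power2_eq_square algebra_simps)
    finally show ?thesis .
  qed
  have "?W t \<le> ?W 0"
  proof (rule right_derivative_nonpos_imp_le [OF t])
    have "continuous_on {0..t} u" "continuous_on {0..t} v" "continuous_on {0..t} (\<lambda>s. F (E B (u s)))"
      unfolding u_def v_def
      using trajectory_continuous [OF phase_bounded_fst zX] trajectory_continuous [OF phase_bounded_snd zX]
        trajectory_continuous [OF phase_bounded_F [OF B(1)] zX]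
      by (auto elim!: continuous_on_subset)
    then show "continuous_on {0..t} ?W" by (intro continuous_intros energy_continuous zX)
    fix s assume s: "0 \<le> s" "s < t"
    note tr = traj [OF s(1)]
    have u': "(u has_vector_derivative v s) (at_right s)"
      using right_derivative [OF phase_bounded_fst zG s(1)] by (simp add: tr(8) flip: u_def)
    have v': "(v has_vector_derivative - (A (u s) + F (v s))) (at_right s)"
      using right_derivative [OF phase_bounded_snd zG s(1)] by (simp add: tr(8) flip: v_def)
    have F': "((\<lambda>s. F (E B (u s))) has_vector_derivative F (v s)) (at_right s)"
      using right_derivative [OF phase_bounded_F [OF B(1)] zG s(1)] by (simp add: tr(2,8) flip: u_def)
    have E': "(?E has_real_derivative - 2 * inner (F (v s)) (v s)) (at_right s)"
      using energy_right_derivative [OF B s(1)] by (simp flip: v_def)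
    note uv' = inner_right_derivative [OF u' v' refl] and Fu' = inner_right_derivative [OF F' u' refl]
    \<comment> \<open>The term in \<open>R u\<close> from the derivative of the mixed product
      cancels against \<open>2 * d\<close> times the energy. What remains of the kinetic part,
      \<open>4 * d * (norm (v s))\<^sup>2\<close>, is absorbed by the damping because
      \<open>2 * d \<le> e\<close>.\<close>
    let ?w = "- 2 * inner (F (v s)) (v s) + 4 * d * (norm (v s))\<^sup>2 - 4 * d * s * inner (F (v s)) (v s)"
    have lin: "((\<lambda>s. 2 * d * s) has_real_derivative 2 * d) (at_right s)"
      by (auto intro!: derivative_eq_intros)
    note W' = DERIV_add [OF DERIV_add [OF DERIV_add [OF E' DERIV_cmult [OF uv', of "2 * d"]]
        DERIV_cmult [OF Fu', of d]] DERIV_mult [OF lin E']]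
    have eqs: "inner (F (u s)) (v s) = inner (F (v s)) (u s)"
      "inner (u s) (- (A (u s) + F (v s))) = - (norm (R (u s)))\<^sup>2 - inner (F (v s)) (u s)"
      "inner (v s) (v s) = (norm (v s))\<^sup>2"
      using fcalc_sym [OF meas_f tr(5,6)]
      by (metis Re_cinner inner_commute)
        (simp_all add: power2_norm_eq_inner R_A [OF tr(3,3)] inner_diff_right inner_commute [of "u s"])
    show "(?W has_real_derivative ?w) (at_right s)"
      using W' [unfolded E_eq tr(1) eqs] unfolding E_eq
      by (rule DERIV_cong) (simp add: algebra_simps)
    have "0 \<le> inner (F (v s)) (v s)"
      using Fv [OF s(1)] d by (meson dual_order.trans less_imp_le mult_nonneg_nonneg mult_pos_pos zero_le_power2 zero_less_numeral)
    moreover have "2 * d * (norm (v s))\<^sup>2 \<le> e * (norm (v s))\<^sup>2" using d by (intro mult_right_mono) auto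
    moreover from calculation(1) have "0 \<le> 4 * d * s * inner (F (v s)) (v s)" using d s(1) by simp
    ultimately show "?w \<le> 0" using Fv [OF s(1)] by linarith
  qed
  moreover have "0 \<le> ?V t"
  proof -
    have "e * (norm (u t))\<^sup>2 \<le> inner (F (u t)) (u t)"
      using traj [OF t] by (intro inner_fcalc_ge [OF meas_f _ BM] e)
    moreover have "0 \<le> e * (norm (u t))\<^sup>2" using d by simp
    ultimately have "0 \<le> inner (F (u t)) (u t)" by linarith
    then have "0 \<le> d * inner (F (E B (u t))) (u t)" using d traj(1) [OF t] by simp
    moreover have "- (2 * d * inner (u t) (v t)) \<le> 2 * d * \<bar>inner (u t) (v t)\<bar>"
      using d by (simp add: abs_if)
    moreover have "0 \<le> ?E t" by simp
    ultimately show ?thesis using uv [OF t] by linarith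
  qed
  moreover have "?V 0 \<le> (3 / 2 + d * C) * ?E 0"
  proof -
    note tr = traj [OF order_refl]
    have "1 * inner (F (u 0)) (u 0) \<le> C * inner (fcalc M E (\<lambda>s. s) (u 0)) (u 0)"
      using tr C by (intro inner_fcalc_mono [OF meas_f _ meas_id _ BM]) (auto simp: D_eq)
    also have "inner (fcalc M E (\<lambda>s. s) (u 0)) (u 0) = (norm (R (u 0)))\<^sup>2"
      using R_A [OF tr(3,3)] A_eq [OF tr(3)] by (simp add: power2_norm_eq_inner)
    finally have Fu: "inner (F (u 0)) (u 0) \<le> C * (norm (R (u 0)))\<^sup>2" by simp
    show ?thesis
    \<comment> \<open>The sign of \<open>C\<close> is read off any point of \<open>B\<close>, where
      \<open>0 < e \<le> f s \<le> C * s\<close>; for empty \<open>B\<close> the data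
      vanish.\<close>
    proof (cases "B = {}")
      case True
      then have "u 0 = 0" "v 0 = 0" using tr(1,2) E_empty by metis+
      then have "S 0 z = 0" by (simp add: u_def v_def prod_eq_iff)
      then show ?thesis by (simp add: J_lin \<open>u 0 = 0\<close>)
    next
      case False
      then obtain s where s: "s \<in> B" by blast
      then have "s \<in> \<sigma>" using sets.sets_into_space [OF BM] by (auto simp: space_M)
      then have "0 < s" using \<sigma>_ge c_pos by force
      moreover have "0 \<le> C * s" using C [OF s] e [OF s] d by linarith
      ultimately have C0: "0 \<le> C" by (simp add: zero_le_mult_iff)
      have "C * (norm (R (u 0)))\<^sup>2 \<le> C * ?E 0" using C0 by (intro mult_left_mono) (simp_all add: E_eq)
      with Fu have "d * inner (F (u 0)) (u 0) \<le> d * (C * ?E 0)" using d by (intro mult_left_mono) auto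
      moreover have "2 * d * inner (u 0) (v 0) \<le> 2 * d * \<bar>inner (u 0) (v 0)\<bar>" using d by simp
      ultimately show ?thesis using uv [OF order_refl] tr(1) by (simp add: algebra_simps)
    qed
  qed
  ultimately show ?thesis by (simp add: S_0 zX)
qed

text \<open>Pairing the second component of \<open>G z\<close> with \<open>u\<close> controls
  \<open>R u\<close>, the form of \<open>F\<close> being dominated by \<open>C\<close> times that of
  \<open>A\<close>. Keeping \<open>b\<close> and \<open>C\<close> separate pays off later: the bound
  is small when \<open>b\<close> is large and \<open>C\<close> is small.\<close>

lemma resolvent_bound:
  assumes B: "tame B" "P B z = z" and b: "0 < b" "\<And>s. s \<in> B \<Longrightarrow> b \<le> s"
    and C: "\<And>s. s \<in> B \<Longrightarrow> f s \<le> C * s" "0 \<le> C"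
  shows "norm (J z) \<le> (2 / sqrt b + C) * norm (J (G z))"
proof -
  have BM: "B \<in> sets M" using B by (auto simp: tame_def)
  note zG = tame_domG [OF B]
  define u where "u = fst z"
  define v where "v = snd z"
  define q where "q = - (A u + F v)"
  have uv: "E B u = u" "E B v = v" "u \<in> D" "v \<in> D" "u \<in> dom f" "v \<in> dom f" "u \<in> H1" "v \<in> H1"
    using zG B(2) D_subset_H1 by (auto simp: u_def v_def P_def prod_eq_iff)
  have Gz: "G z = (v, q)" using zG(2) by (simp add: u_def v_def q_def)
  define x where "x = norm (R v)"
  define y where "y = norm (R u)"
  have xy: "sqrt b * norm v \<le> x" "sqrt b * norm u \<le> y"
    unfolding x_def y_def using uv b by (auto intro!: R_lower_bound BM)
  have sb: "sqrt b > 0" using b by simp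
  have Fw: "inner (F w) w \<le> C * (norm (R w))\<^sup>2" "0 \<le> inner (F w) w" if w: "E B w = w" for w
  proof -
    note wd = tameD [OF B(1) w]
    have "1 * inner (F w) w \<le> C * inner (fcalc M E (\<lambda>s. s) w) w"
      using wd w C by (intro inner_fcalc_mono [OF meas_f _ meas_id _ BM]) (auto simp: D_eq)
    also have "inner (fcalc M E (\<lambda>s. s) w) w = (norm (R w))\<^sup>2"
      using R_A [OF wd(1,1)] A_eq [OF wd(1)] by (simp add: power2_norm_eq_inner)
    finally show "inner (F w) w \<le> C * (norm (R w))\<^sup>2" by simp
    have "0 * (norm w)\<^sup>2 \<le> inner (F w) w"
      using sets.sets_into_space [OF BM]
      by (intro inner_fcalc_ge [OF meas_f wd(2) BM w] f_nonneg) (auto simp: space_M)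
    then show "0 \<le> inner (F w) w" by simp
  qed
  \<comment> \<open>The Cauchy-Schwarz inequality for the semidefinite form of \<open>F\<close>. The
    weights \<open>y\<close> and \<open>x\<close> in \<open>?w\<close> balance the summands, both
    having \<open>R\<close>-norm \<open>x * y\<close>.\<close>
  have m: "- inner (F v) u \<le> C * x * y"
  proof (cases "x = 0 \<or> y = 0")
    case True
    then have "u = 0 \<or> v = 0" using xy sb by (auto simp: mult_le_0_iff)
    then show ?thesis using True by (auto simp: F_lin)
  next
    case False
    then have pos: "x > 0" "y > 0" by (auto simp: x_def y_def)
    let ?w = "y *\<^sub>R v + x *\<^sub>R u"
    have "E B ?w = ?w" using uv by (simp add: E_add E_scaleR BM)
    then have "0 \<le> inner (F ?w) ?w" by (rule Fw)
    also have "F ?w = y *\<^sub>R F v + x *\<^sub>R F u" using uv by (simp add: F_lin)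
    also have "inner (y *\<^sub>R F v + x *\<^sub>R F u) ?w =
      y * y * inner (F v) v + x * y * inner (F v) u + x * y * inner (F u) v + x * x * inner (F u) u"
      by (simp add: inner_add_left inner_add_right algebra_simps)
    also have "inner (F u) v = inner (F v) u"
      using fcalc_sym [OF meas_f uv(5,6)] by (metis Re_cinner inner_commute)
    finally have "x * y * (- 2 * inner (F v) u) \<le> y * y * inner (F v) v + x * x * inner (F u) u"
      by (simp add: algebra_simps)
    also have "\<dots> \<le> y * y * (C * x\<^sup>2) + x * x * (C * y\<^sup>2)"
      using Fw(1) [OF uv(1)] Fw(1) [OF uv(2)] by (intro add_mono mult_left_mono) (auto simp: x_def y_def)
    also have "\<dots> = x * y * (2 * (C * x * y))" by (simp add: power2_eq_square algebra_simps)
    finally have "- 2 * inner (F v) u \<le> 2 * (C * x * y)"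
      using mult_pos_pos [OF pos] by (simp only: mult_le_cancel_left_pos)
    then show ?thesis by simp
  qed
  have "y * y = inner (A u) u" using R_A [OF uv(3,3)] by (simp add: y_def flip: power2_norm_eq_inner power2_eq_square)
  also have "\<dots> = - inner q u - inner (F v) u" by (simp add: q_def inner_diff_left)
  also have "- inner q u \<le> norm q * norm u"
    using norm_cauchy_schwarz [of "- q" u] by simp
  also have "norm q * norm u \<le> norm q * (y / sqrt b)"
    using xy sb by (intro mult_left_mono) (auto simp: field_simps)
  finally have "y * y \<le> (norm q / sqrt b + C * x) * y" using m by (simp add: algebra_simps)
  then have y: "y \<le> norm q / sqrt b + C * x"
    using sb C(2) by (cases "y = 0") (auto simp: y_def x_def)
  have JG: "x \<le> norm (J (G z))" "norm q \<le> norm (J (G z))"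
    using norm_fst_le [of "R v" q] norm_snd_le [of q "R v"] by (simp_all add: J_def Gz x_def)
  have "norm (J z) \<le> y + norm v"
    using norm_Pair_le [of "R u" v] by (simp add: J_def y_def u_def v_def)
  also have "norm v \<le> x / sqrt b" using xy sb by (simp add: field_simps)
  also have "y + x / sqrt b \<le> norm (J (G z)) / sqrt b + C * x + norm (J (G z)) / sqrt b"
    using y JG sb by (intro add_mono order_trans [OF y] add_right_mono divide_right_mono) auto
  also have "C * x \<le> C * norm (J (G z))"
    using JG C(2) by (intro mult_left_mono)
  finally show ?thesis by (simp add: algebra_simps)
qed

end

section \<open>Semiuniform stability\<close>

text \<open>The infimum of all admissible constants at time \<open>t\<close> serves as the rate: it
  inherits smallness from every \<open>e\<close>, and the bound \<open>K\<close> ensures that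
  admissible constants exist from time 0 on.\<close>

lemma semiuniformly_stableI:
  fixes N :: "'b \<Rightarrow> real"
  assumes nonneg: "\<And>z. 0 \<le> N z"
    and bounded: "\<And>t z. 0 \<le> t \<Longrightarrow> z \<in> V \<Longrightarrow> N (S t z) \<le> K * N (G z)"
    and decay: "\<And>e. 0 < e \<Longrightarrow> \<exists>T. \<forall>t\<ge>T. \<forall>z\<in>V. N (S t z) \<le> e * N (G z)"
  shows "semiuniformly_stable N S V G"
proof -
  define Q where "Q t = {a. 0 \<le> a \<and> (\<forall>z\<in>V. N (S t z) \<le> a * N (G z))}" for t
  define \<psi> where "\<psi> t = Inf (Q t)" for t
  have KQ: "\<bar>K\<bar> \<in> Q t" if "0 \<le> t" for t
    unfolding Q_def
  proof (intro CollectI conjI ballI)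
    fix z assume "z \<in> V"
    then have "N (S t z) \<le> K * N (G z)" by (rule bounded [OF that])
    also have "\<dots> \<le> \<bar>K\<bar> * N (G z)" by (intro mult_right_mono nonneg) simp
    finally show "N (S t z) \<le> \<bar>K\<bar> * N (G z)" .
  qed simp
  have bdd: "bdd_below (Q t)" for t by (rule bdd_belowI [of _ 0]) (simp add: Q_def)
  have \<psi>0: "0 \<le> \<psi> t" if "0 \<le> t" for t
    unfolding \<psi>_def
  proof (rule cInf_greatest)
    show "Q t \<noteq> {}" using KQ [OF that] by blast
  qed (simp add: Q_def)
  have "N (S t z) \<le> \<psi> t * N (G z)" if t: "0 \<le> t" and z: "z \<in> V" for t z
  proof (cases "N (G z) = 0")
    case True
    then show ?thesis using bounded [OF t z] by simp
  next
    case False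
    then have pos: "N (G z) > 0" using nonneg [of "G z"] by simp
    have "N (S t z) / N (G z) \<le> \<psi> t"
      unfolding \<psi>_def
    proof (rule cInf_greatest)
      show "Q t \<noteq> {}" using KQ [OF t] by blast
    qed (use z pos in \<open>auto simp: Q_def pos_divide_le_eq\<close>)
    then show ?thesis using pos by (simp add: pos_divide_le_eq)
  qed
  moreover have "(\<psi> \<longlongrightarrow> 0) at_top"
  proof (rule tendstoI)
    fix e :: real assume e: "e > 0"
    then obtain T where T: "\<And>t z. T \<le> t \<Longrightarrow> z \<in> V \<Longrightarrow> N (S t z) \<le> (e / 2) * N (G z)"
      using decay [of "e / 2"] by auto
    have "dist (\<psi> t) 0 < e" if "max T 0 \<le> t" for t
    proof -
      have "e / 2 \<in> Q t" using T that e by (auto simp: Q_def)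
      then have "\<psi> t \<le> e / 2" unfolding \<psi>_def by (intro cInf_lower bdd)
      then show ?thesis using \<psi>0 [of t] that e by (simp add: dist_real_def)
    qed
    then show "\<forall>\<^sub>F t in at_top. dist (\<psi> t) 0 < e"
      unfolding eventually_at_top_linorder by blast
  qed
  ultimately show ?thesis unfolding semiuniformly_stable_def using \<psi>0 by blast
qed

section \<open>Necessity: test data from approximate eigenvectors\<close>

context wave
begin

text \<open>If \<open>E B\<close> vanished for a neighbourhood \<open>B\<close> of \<open>s\<close>,
  then \<open>A - s\<close> would be bounded below, against \<open>s\<close> being spectral.
  Continuity of \<open>f\<close> makes the vector an approximate eigenvector of \<open>f(A)\<close>
  as well.\<close>

lemma spectral_point:
  assumes s: "s \<in> \<sigma>" and e: "e > 0"
  obtains B x where "tame B" "E B x = x" "x \<noteq> 0" "\<And>r. r \<in> B \<Longrightarrow> \<bar>r - s\<bar> \<le> e"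
    "\<And>r. r \<in> B \<Longrightarrow> \<bar>f r - f s\<bar> \<le> e"
proof -
  obtain d where d: "d > 0" "\<And>r. r \<in> \<sigma> \<Longrightarrow> \<bar>r - s\<bar> < d \<Longrightarrow> \<bar>f r - f s\<bar> < e"
    using f_cont s e unfolding continuous_on_iff dist_real_def by blast
  define d' where "d' = min d e"
  have d': "d' > 0" using d e by (simp add: d'_def)
  define B where "B = {r \<in> space M. \<bar>r - s\<bar> < d'}"
  have BM: "B \<in> sets M" unfolding B_def using meas_id by measurable
  have B: "\<bar>r - s\<bar> \<le> e" "\<bar>f r - f s\<bar> \<le> e" if "r \<in> B" for r
    using that d(2) [of r] by (auto simp: B_def space_M d'_def)
  have "tame B" unfolding tame_def
    using BM B by (intro conjI exI [of _ "max (s + e) (f s + e)"]) (fastforce simp: abs_le_iff)+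
  moreover have "\<exists>x. E B x \<noteq> 0"
  proof (rule ccontr)
    assume "\<not> ?thesis"
    then have C: "E (space M - B) x = x" for x using E_Compl [OF BM, of x] by simp
    have "d' * norm x \<le> norm (A x - s *\<^sub>R x)" if x: "x \<in> D" for x
    proof -
      have "d' * norm x \<le> norm (fcalc M E (\<lambda>s. s) x - s *\<^sub>R x)"
        by (rule norm_fcalc_diff_ge [OF meas_id _ _ C]) (use x BM d' in \<open>auto simp: D_eq B_def\<close>)
      then show ?thesis using x by (simp add: A_eq)
    qed
    then show False using not_in_rspectrum [OF selfadjoint d'] s by blast
  qed
  then obtain y where "E B y \<noteq> 0" by blast
  ultimately show thesis using that [of B "E B y"] B E_idem [OF BM] by blast
qed

end

context wave_semigroup
begin

lemma zero_free_of_stable: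
  assumes "semiuniformly_stable N S domG G"
  shows "{s \<in> \<sigma>. f s = 0} = {}"
proof (rule ccontr)
  assume "\<not> ?thesis"
  then obtain s where s: "s \<in> \<sigma>" "f s = 0" by blast
  obtain \<psi> :: "real \<Rightarrow> real" where \<psi>: "\<And>t. 0 \<le> t \<Longrightarrow> 0 \<le> \<psi> t" "(\<psi> \<longlongrightarrow> 0) at_top"
    "\<And>z t. z \<in> domG \<Longrightarrow> 0 \<le> t \<Longrightarrow> norm (J (S t z)) \<le> \<psi> t * norm (J (G z))"
    using assms unfolding semiuniformly_stable_def N_eq by blast
  have s0: "0 < s" using \<sigma>_ge [OF s(1)] c_pos by simp
  \<comment> \<open>\<open>L\<close> will bound \<open>norm (A x)\<close> by
    \<open>norm (R x)\<close>, since the spectral set stays below \<open>s + 1\<close>. It does not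
    depend on \<open>e\<close>, so \<open>t\<close> can be fixed before \<open>e\<close>.\<close>
  define L where "L = (s + 1) / sqrt c"
  have L: "0 < L" using s0 c_pos by (simp add: L_def)
  have "\<forall>\<^sub>F t in at_top. \<psi> t < 1 / (2 * L)"
    using L by (intro order_tendstoD(2) [OF \<psi>(2)]) simp
  moreover have "\<forall>\<^sub>F t in at_top. t > (0::real)" by (rule eventually_gt_at_top)
  ultimately have "\<forall>\<^sub>F t in at_top. \<psi> t < 1 / (2 * L) \<and> t > 0" by (rule eventually_conj)
  then obtain t where t: "\<psi> t < 1 / (2 * L)" "t > 0"
    using eventually_happens' [OF trivial_limit_at_top_linorder] by blast
  \<comment> \<open>With \<open>e \<le> 1 / (4 * t)\<close> at least half of the energy survives
    until time \<open>t\<close>, while the choice of \<open>t\<close> leaves at most a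
    quarter.\<close>
  define e where "e = min 1 (1 / (4 * t))"
  have e: "0 < e" "e \<le> 1" "e \<le> 1 / (4 * t)" using t by (auto simp: e_def)
  obtain B x where B: "tame B" "E B x = x" "x \<noteq> 0" "\<And>r. r \<in> B \<Longrightarrow> \<bar>r - s\<bar> \<le> e"
    "\<And>r. r \<in> B \<Longrightarrow> \<bar>f r - f s\<bar> \<le> e"
    using spectral_point [OF s(1) e(1)] by blast
  have BM: "B \<in> sets M" using B by (simp add: tame_def)
  note xD = tameD [OF B(1,2)]
  let ?z = "(x, 0)"
  have z: "P B ?z = ?z" by (simp add: P_def B E_zero BM)
  note zG = tame_domG [OF B(1) z]
  have Jz: "norm (J ?z) = norm (R x)" by (simp add: J_def norm_prod_def)
  have "sqrt c * norm x \<le> norm (R x)" by (rule R_ge [OF xD(3)])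
  then have x_le: "norm x \<le> norm (R x) / sqrt c" using c_pos by (simp add: field_simps)
  have Rx: "norm (R x) > 0"
    using x_le B(3) c_pos by (smt (verit) divide_le_0_iff real_sqrt_gt_zero zero_less_norm_iff)
  have "norm (fcalc M E (\<lambda>s. s) x - 0 *\<^sub>R x) \<le> (s + 1) * norm x"
  proof (rule norm_fcalc_diff_le [OF meas_id _ BM B(2)])
    show "x \<in> dom (\<lambda>s. s)" using xD by (simp add: D_eq)
    show "\<bar>r - 0\<bar> \<le> s + 1" if "r \<in> B" for r using B(4) [OF that] e(2) s0 by linarith
  qed (use s0 in simp)
  then have "norm (A x) \<le> (s + 1) * norm x" by (simp add: A_eq xD)
  also have "\<dots> \<le> (s + 1) * (norm (R x) / sqrt c)" using s0 by (intro mult_left_mono x_le) simp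
  finally have Ax: "norm (A x) \<le> L * norm (R x)" by (simp add: L_def)
  have "J (G ?z) = (0, - A x)" using zG(2) by (simp add: J_def R_lin F_lin)
  then have JG: "norm (J (G ?z)) \<le> L * norm (R x)" using Ax by (simp add: norm_prod_def)
  have "norm (J (S t ?z)) \<le> \<psi> t * norm (J (G ?z))" using \<psi>(3) zG(1) t by simp
  also have "\<dots> \<le> \<psi> t * (L * norm (R x))" using \<psi>(1) t JG by (intro mult_left_mono) auto
  also have "\<dots> \<le> 1 / (2 * L) * (L * norm (R x))" using t L by (intro mult_right_mono) auto
  also have "\<dots> = norm (R x) / 2" using L by simp
  finally have "(norm (J (S t ?z)))\<^sup>2 \<le> (norm (R x) / 2)\<^sup>2" by (intro power_mono) auto
  moreover have "(1 - 2 * e * t) * (norm (J ?z))\<^sup>2 \<le> (norm (J (S t ?z)))\<^sup>2"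
    using B(5) s(2) e t by (intro energy_lower_bound [OF B(1) z]) (auto simp: abs_le_iff)
  moreover have "1 / 2 * (norm (J ?z))\<^sup>2 \<le> (1 - 2 * e * t) * (norm (J ?z))\<^sup>2"
    using e(3) t(2) by (intro mult_right_mono) (auto simp: field_simps)
  ultimately have "1 / 2 * (norm (R x))\<^sup>2 \<le> (norm (R x) / 2)\<^sup>2" unfolding Jz by linarith
  moreover have "(norm (R x))\<^sup>2 > 0" using Rx by simp
  ultimately show False by (simp add: power_divide)
qed

lemma bounded_quotient_of_stable:
  assumes "semiuniformly_stable N S domG G"
  shows "\<exists>C. \<forall>s\<in>\<sigma>. f s / s \<le> C"
proof -
  obtain \<psi> :: "real \<Rightarrow> real" where \<psi>: "\<And>t. 0 \<le> t \<Longrightarrow> 0 \<le> \<psi> t"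
    "\<And>z t. z \<in> domG \<Longrightarrow> 0 \<le> t \<Longrightarrow> norm (J (S t z)) \<le> \<psi> t * norm (J (G z))"
    using assms unfolding semiuniformly_stable_def N_eq by blast
  have "f s / s \<le> 2 * \<psi> 0" if s: "s \<in> \<sigma>" for s
  proof -
    have s0: "0 < s" using \<sigma>_ge [OF s] c_pos by simp
    define k where "k = f s / s"
    have k0: "0 \<le> k" using f_nonneg [OF s] s0 by (simp add: k_def)
    \<comment> \<open>Makes the residual \<open>(1 + k) * e * norm x\<close> equal to
      \<open>sqrt c * norm x\<close>, hence at most \<open>norm (R x)\<close>.\<close>
    define e where "e = sqrt c / (1 + k)"
    have e: "0 < e" using c_pos k0 by (simp add: e_def)
    obtain B x where B: "tame B" "E B x = x" "x \<noteq> 0" "\<And>r. r \<in> B \<Longrightarrow> \<bar>r - s\<bar> \<le> e"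
      "\<And>r. r \<in> B \<Longrightarrow> \<bar>f r - f s\<bar> \<le> e"
      using spectral_point [OF s e] by blast
    have BM: "B \<in> sets M" using B by (simp add: tame_def)
    note xD = tameD [OF B(1,2)]
    \<comment> \<open>The first component approximates - A^{-1} f(A) x, so that the second component
      of \<open>G ?z\<close> is only a residual, whereas \<open>J ?z\<close> has norm at least
      \<open>k * norm (R x)\<close>.\<close>
    let ?z = "(- (k *\<^sub>R x), x)"
    have z: "P B ?z = ?z" by (simp add: P_def B E_minus E_scaleR BM)
    note zG = tame_domG [OF B(1) z]
    have x_le: "sqrt c * norm x \<le> norm (R x)" by (rule R_ge [OF xD(3)])
    moreover have "0 < sqrt c * norm x" using B(3) c_pos by simp
    ultimately have Rx: "norm (R x) > 0" by linarith
    have "norm (fcalc M E (\<lambda>s. s) x - s *\<^sub>R x) \<le> e * norm x"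
      using xD B(4) e by (intro norm_fcalc_diff_le [OF meas_id _ BM B(2)]) (auto simp: D_eq)
    then have 1: "norm (A x - s *\<^sub>R x) \<le> e * norm x" by (simp add: A_eq xD)
    have 2: "norm (F x - f s *\<^sub>R x) \<le> e * norm x"
      using xD B(5) e by (intro norm_fcalc_diff_le [OF meas_f _ BM B(2)]) auto
    have "A (- (k *\<^sub>R x)) + F x = (F x - f s *\<^sub>R x) - k *\<^sub>R (A x - s *\<^sub>R x)"
      using s0 xD by (simp add: A_lin k_def scaleR_diff_right)
    then have "norm (A (- (k *\<^sub>R x)) + F x) \<le> norm (F x - f s *\<^sub>R x) + k * norm (A x - s *\<^sub>R x)"
      using norm_triangle_ineq4 [of "F x - f s *\<^sub>R x" "k *\<^sub>R (A x - s *\<^sub>R x)"] k0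
      by (simp only: norm_scaleR abs_of_nonneg)
    also have "\<dots> \<le> e * norm x + k * (e * norm x)" using 1 2 k0 by (intro add_mono mult_left_mono)
    also have "\<dots> = (1 + k) * e * norm x" by (simp add: algebra_simps)
    also have "(1 + k) * e = sqrt c" using k0 by (simp add: e_def)
    finally have q: "norm (A (- (k *\<^sub>R x)) + F x) \<le> norm (R x)" using x_le by simp
    have "norm (J (G ?z)) \<le> norm (R x) + norm (A (- (k *\<^sub>R x)) + F x)"
      using norm_Pair_le [of "R x" "- (A (- (k *\<^sub>R x)) + F x)"] zG(2)
      by (simp only: J_def fst_conv snd_conv norm_minus_cancel)
    then have JG: "norm (J (G ?z)) \<le> 2 * norm (R x)" using q by simp
    have "k * norm (R x) = norm (R (- (k *\<^sub>R x)))" using k0 xD by (simp add: R_lin)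
    also have "\<dots> \<le> norm (J ?z)" using norm_fst_le by (simp add: J_def)
    also have "\<dots> \<le> \<psi> 0 * norm (J (G ?z))" using \<psi>(2) [OF zG(1), of 0] by (simp add: S_0 zG(7))
    also have "\<dots> \<le> \<psi> 0 * (2 * norm (R x))" using \<psi>(1) JG by (intro mult_left_mono) auto
    finally have "k * norm (R x) \<le> (2 * \<psi> 0) * norm (R x)" by simp
    then show ?thesis unfolding k_def using Rx by (simp only: mult_le_cancel_right_pos)
  qed
  then show ?thesis by blast
qed

text \<open>A bound on the spectral subspaces of tame sets extends to all of the domain, since these
  subspaces are invariant and their union is dense.\<close>

lemma bound_from_tame:
  assumes t: "0 \<le> t" and a: "0 \<le> a" and z: "z \<in> domG"
    and tame: "\<And>B z. tame B \<Longrightarrow> P B z = z \<Longrightarrow> norm (J (S t z)) \<le> a * norm (J (G z))"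
  shows "norm (J (S t z)) \<le> a * norm (J (G z))"
proof -
  note zX = domGD(1,2) [OF z]
  let ?g = "\<lambda>s. \<bar>s\<bar> + \<bar>f s\<bar>"
  define B where "B n = {s \<in> space M. \<bar>?g s\<bar> \<le> real n}" for n
  have g: "?g \<in> borel_measurable M" using meas_id meas_f by measurable
  have BM: "B n \<in> sets M" for n unfolding B_def using g by measurable
  have tB: "tame (B n)" for n
    unfolding tame_def using BM by (auto simp: B_def intro!: exI [of _ "real n"])
  have "(\<lambda>n. P (B n) (J z)) \<longlonglongrightarrow> (fst (J z), snd (J z))"
    unfolding P_def B_def by (intro tendsto_Pair truncation_tendsto g)
  then have lim: "(\<lambda>n. P (B n) (J z)) \<longlonglongrightarrow> J z" by simp
  have "norm (J (S t z)) \<le> a * norm (J (G z)) + norm (J z - P (B n) (J z))" for n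
  proof -
    let ?y = "P (B n) z"
    have yX: "?y \<in> X" by (rule P_in_X [OF BM zX(1)])
    have Py: "P (B n) ?y = ?y" by (simp add: P_def E_idem [OF BM])
    have "norm (J (S t ?y)) \<le> a * norm (J (G ?y))" by (rule tame [OF tB Py])
    also have "J (G ?y) = P (B n) (J (G z))" using domG_P [OF BM z] J_P [OF BM zX(2)] by simp
    also have "a * norm \<dots> \<le> a * norm (J (G z))" by (intro mult_left_mono norm_P_le BM a)
    finally have 1: "norm (J (S t ?y)) \<le> a * norm (J (G z))" .
    have X: "S t z \<in> X" "S t ?y \<in> X" "z - ?y \<in> X" using S_X [OF t] zX yX J_lin(6) by auto
    have "J (S t z) - J (S t ?y) = J (S t (z - ?y))"
      using X zX yX S_lin(11) [OF t zX(1) yX] by (simp add: J_lin)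
    moreover have "norm (J (S t (z - ?y))) \<le> norm (J (z - ?y))" by (rule S_contr [OF t X(3)])
    moreover have "J (z - ?y) = J z - P (B n) (J z)" using zX yX J_P [OF BM zX(1)] by (simp add: J_lin)
    ultimately have "norm (J (S t z) - J (S t ?y)) \<le> norm (J z - P (B n) (J z))" by simp
    then show ?thesis using 1 norm_triangle_sub [of "J (S t z)" "J (S t ?y)"] by linarith
  qed
  moreover have "(\<lambda>n. a * norm (J (G z)) + norm (J z - P (B n) (J z))) \<longlonglongrightarrow>
      a * norm (J (G z)) + norm (J z - J z)"
    by (intro tendsto_intros lim)
  ultimately show ?thesis
    by (intro tendsto_lowerbound [of _ "a * norm (J (G z))" sequentially]) auto
qed

section \<open>Sufficiency: splitting by the size of the damping\<close>

lemma stable_of_bounded_quotient: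
  assumes pos: "\<And>s. s \<in> \<sigma> \<Longrightarrow> 0 < f s" and C: "\<And>s. s \<in> \<sigma> \<Longrightarrow> f s \<le> C * s" "0 \<le> C"
  shows "semiuniformly_stable N S domG G"
proof -
  \<comment> \<open>The bound of the inverse on all tame data, taken at the bottom \<open>c\<close>
    of the spectrum. It converts initial energy into the norm of \<open>G z\<close>.\<close>
  define K where "K = 2 / sqrt c + C"
  have K0: "0 \<le> K" using c_pos C by (simp add: K_def)
  have K: "norm (J z) \<le> K * norm (J (G z))" if B: "tame B" "P B z = z" for B z
  proof -
    have "s \<in> \<sigma>" if "s \<in> B" for s
      using B(1) sets.sets_into_space [of B M] that by (auto simp: tame_def space_M)
    then show ?thesis unfolding K_def using \<sigma>_ge C c_pos by (intro resolvent_bound [OF B]) auto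
  qed
  show ?thesis
  proof (rule semiuniformly_stableI)
    show "0 \<le> N z" for z by (simp add: N_eq)
    fix t :: real and z assume t: "0 \<le> t" and z: "z \<in> domG"
    show "N (S t z) \<le> K * N (G z)"
      unfolding N_eq
    proof (rule bound_from_tame [OF t K0 z])
      fix B z assume "tame B" "P B z = z"
      then show "norm (J (S t z)) \<le> K * norm (J (G z))"
        using order_trans [OF S_contr [OF t] K] tame_domG(7) by blast
    qed
  next
    fix e :: real assume e: "0 < e"
    \<comment> \<open>The number 36 gives \<open>3 / sqrt r \<le> e / 2\<close>;
      \<open>r \<ge> 1\<close> gives \<open>1 / r \<le> 1 / sqrt r\<close>.\<close>
    define r where "r = max 1 (36 / e\<^sup>2)"
    have r: "1 \<le> r" "36 / e\<^sup>2 \<le> r" by (auto simp: r_def)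
    \<comment> \<open>\<open>h \<le> 1\<close> is imposed so that \<open>f s < h\<close> also yields
      \<open>f s \<le> s / r\<close>, because such \<open>s\<close> are at least
      \<open>r\<close>.\<close>
    obtain h where h: "0 < h" "h \<le> 1" "\<And>s. s \<in> \<sigma> \<Longrightarrow> s \<le> r \<Longrightarrow> h \<le> f s"
    proof (cases "\<sigma> \<inter> {..r} = {}")
      case True
      then show ?thesis using that [of 1] by auto
    next
      case False
      have "\<sigma> \<inter> {..r} = \<sigma> \<inter> {c..r}" using \<sigma>_ge by auto
      then have "compact (\<sigma> \<inter> {..r})"
        using closed_Int_compact [OF closed_rspectrum [OF selfadjoint] compact_Icc] by simp
      moreover have "continuous_on (\<sigma> \<inter> {..r}) f" by (rule continuous_on_subset [OF f_cont]) auto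
      ultimately have "\<exists>m\<in>\<sigma> \<inter> {..r}. \<forall>s\<in>\<sigma> \<inter> {..r}. f m \<le> f s"
        using False by (intro continuous_attains_inf)
      then obtain m where m: "m \<in> \<sigma>" "\<And>s. s \<in> \<sigma> \<inter> {..r} \<Longrightarrow> f m \<le> f s" by auto
      show ?thesis
      proof (rule that [of "min 1 (f m)"])
        show "min 1 (f m) \<le> f s" if "s \<in> \<sigma>" "s \<le> r" for s
          using m(2) [of s] that by simp
      qed (use pos [OF m(1)] in auto)
    qed
    define d where "d = min (h / 2) (sqrt c / 2)"
    have d: "0 < d" "2 * d \<le> h" "2 * d \<le> sqrt c" using h c_pos by (auto simp: d_def)
    define k where "k = (3 / 2 + d * C) * K\<^sup>2"
    \<comment> \<open>For \<open>t \<ge> T\<close> the decay estimate, with initial energy expressed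
      through \<open>K\<close>, puts the squared norm below \<open>(e / 2)\<^sup>2\<close> times
      that of \<open>G z\<close>.\<close>
    define T where "T = max 1 (2 * k / (d * e\<^sup>2))"
    show "\<exists>T. \<forall>t\<ge>T. \<forall>z\<in>domG. N (S t z) \<le> e * N (G z)"
    proof (intro exI allI impI ballI)
      fix t z assume "T \<le> t" and z: "z \<in> domG"
      then have t: "1 \<le> t" "2 * k / (d * e\<^sup>2) \<le> t" by (auto simp: T_def)
      then have t0: "0 \<le> t" by simp
      show "N (S t z) \<le> e * N (G z)"
        unfolding N_eq
      proof (rule bound_from_tame [OF t0 _ z])
        show "0 \<le> e" using e by simp
        fix B z assume B: "tame B" "P B z = z"
        have BM: "B \<in> sets M" using B by (simp add: tame_def)
        have B\<sigma>: "s \<in> \<sigma>" if "s \<in> B" for s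
          using sets.sets_into_space [OF BM] that by (auto simp: space_M)
        define B1 where "B1 = {s \<in> space M. h \<le> f s}"
        define B2 where "B2 = \<sigma> - B1"
        have B1: "B1 \<in> sets M" unfolding B1_def using meas_f by measurable
        have B2: "B2 \<in> sets M" unfolding B2_def using sets.compl_sets [OF B1] by (simp add: space_M)
        \<comment> \<open>Truncating data that are already in the range of \<open>E B\<close> leaves
          them supported on \<open>B \<inter> C'\<close>, which is again tame.\<close>
        have E1: "E (B \<inter> C') (E C' x) = E C' x" if "E B x = x" "C' \<in> sets M" for C' x
          using E_Int [OF BM that(2), of "E C' x"] E_idem [OF that(2), of x] E_commute [OF BM that(2), of x] that(1)
          by simp
        have Bz: "E B (fst z) = fst z" "E B (snd z) = snd z" using B(2) by (auto simp: P_def prod_eq_iff)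
        have t1: "tame (B \<inter> B1)" "P (B \<inter> B1) (P B1 z) = P B1 z"
          and t2: "tame (B \<inter> B2)" "P (B \<inter> B2) (P B2 z) = P B2 z"
          using B(1) B1 B2 E1 Bz by (auto simp: P_def intro: tame_Int)
        have zX: "z \<in> X" "G z \<in> X" "z \<in> domG" using tame_domG [OF B] by auto
        have JG: "norm (J (G (P C' z))) \<le> norm (J (G z))" if "C' \<in> sets M" for C'
          using domG_P [OF that zX(3)] J_P [OF that zX(2)] norm_P_le [OF that] by simp
        have 1: "norm (J (S t (P B1 z))) \<le> e / 2 * norm (J (G z))"
        proof -
          have "2 * d * t * (norm (J (S t (P B1 z))))\<^sup>2 \<le> (3 / 2 + d * C) * (norm (J (P B1 z)))\<^sup>2"
            by (rule energy_decay [OF t1 t0 _ _ d]) (use B\<sigma> C in \<open>auto simp: B1_def\<close>)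
          also have "\<dots> \<le> (3 / 2 + d * C) * (K * norm (J (G z)))\<^sup>2"
            using order_trans [OF K [OF t1] mult_left_mono [OF JG [OF B1] K0]] d C
            by (intro mult_left_mono power_mono) auto
          also have "\<dots> = k * (norm (J (G z)))\<^sup>2" by (simp add: k_def power_mult_distrib)
          also have "\<dots> \<le> (t * d * e\<^sup>2 / 2) * (norm (J (G z)))\<^sup>2"
            using t(2) d e by (intro mult_right_mono) (auto simp: field_simps)
          also have "\<dots> = 2 * d * t * (e / 2 * norm (J (G z)))\<^sup>2"
            by (simp add: power_mult_distrib power_divide)
          finally have "(norm (J (S t (P B1 z))))\<^sup>2 \<le> (e / 2 * norm (J (G z)))\<^sup>2"
            using d t by simp
          then show ?thesis by (rule power2_le_imp_le) (use e in simp)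
        qed
        have 2: "norm (J (S t (P B2 z))) \<le> e / 2 * norm (J (G z))"
        proof -
          \<comment> \<open>On this part the constant \<open>C\<close> of the inverse estimate can
            be replaced by \<open>1 / r\<close>; with \<open>C\<close> itself the bound would not
            become small.\<close>
          have sB: "r \<le> s \<and> f s \<le> (1 / r) * s" if "s \<in> B \<inter> B2" for s
          proof -
            have s: "s \<in> \<sigma>" "f s < h" using that by (auto simp: B2_def B1_def space_M)
            then have "r \<le> s" using h(3) [of s] by force
            moreover have "1 \<le> (1 / r) * s" using \<open>r \<le> s\<close> r by (simp add: field_simps)
            ultimately show ?thesis using s(2) h(2) by simp
          qed
          have "norm (J (S t (P B2 z))) \<le> norm (J (P B2 z))"
            by (intro S_contr t0 P_in_X B2 zX)
          also have "\<dots> \<le> (2 / sqrt r + 1 / r) * norm (J (G (P B2 z)))"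
            using sB r by (intro resolvent_bound [OF t2]) auto
          also have "\<dots> \<le> e / 2 * norm (J (G z))"
          proof (rule mult_mono [OF _ JG [OF B2]])
            have sr: "6 / e \<le> sqrt r" "1 \<le> sqrt r"
              using r e by (auto intro!: real_le_rsqrt simp: power_divide)
            have "sqrt r * 1 \<le> sqrt r * sqrt r" using sr by (intro mult_left_mono) auto
            then have "1 / r \<le> 1 / sqrt r" using r sr by (intro divide_left_mono) auto
            then have "2 / sqrt r + 1 / r \<le> 3 / sqrt r" by (simp add: field_simps)
            also have "\<dots> \<le> e / 2" using sr e by (simp add: field_simps)
            finally show "2 / sqrt r + 1 / r \<le> e / 2" .
          qed (use e in auto)
          finally show ?thesis .
        qed
        have PX: "P B1 z \<in> X" "P B2 z \<in> X" using P_in_X zX B1 B2 by auto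
        have "P B1 z + P B2 z = z" using P_Compl [OF B1, of z] by (simp add: B2_def)
        then have "J (S t z) = J (S t (P B1 z)) + J (S t (P B2 z))"
          using S_lin(7) [OF t0 PX] S_X [OF t0] PX by (simp add: J_lin(7))
        then have "norm (J (S t z)) \<le> norm (J (S t (P B1 z))) + norm (J (S t (P B2 z)))"
          by (simp add: norm_triangle_ineq)
        then show "norm (J (S t z)) \<le> e * norm (J (G z))" using 1 2 by simp
      qed
    qed
  qed
qed

end

theorem theorem11p3:
  fixes D :: "'a::chilbert_space set"
    and A :: "'a \<Rightarrow> 'a"
    and E :: "real set \<Rightarrow> 'a \<Rightarrow> 'a"
    and f :: "real \<Rightarrow> real"
    and S :: "real \<Rightarrow> 'a \<times> 'a \<Rightarrow> 'a \<times> 'a"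
  assumes separable: "\<exists>Q::'a set. countable Q \<and> closure Q = UNIV"
    and selfadjoint: "selfadjoint D A"
    and positive: "strictly_positive D A"
    and E: "is_spectral_measure_of E D A"
    and f_cont: "continuous_on (rspectrum D A) f"
    and f_nonneg: "\<forall>s\<in>rspectrum D A. 0 \<le> f s"
    and semigroup: "contraction_semigroup (phase_space D A E) (phase_norm D A E) S"
    and generator: "generated_by (phase_space D A E) (phase_norm D A E) S
      (wave_dom D A E f) (wave_op D A E f)"
  shows "semiuniformly_stable (phase_norm D A E) S (wave_dom D A E f) (wave_op D A E f) \<longleftrightarrow>
    {s \<in> rspectrum D A. f s = 0} = {} \<and> (SUP s\<in>rspectrum D A. ereal (f s / s)) < \<infinity>"
proof -
  obtain c where c: "c > 0" "\<And>x. x \<in> D \<Longrightarrow> c * (norm x)\<^sup>2 \<le> Re (cinner (A x) x)"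
    using positive unfolding strictly_positive_def by blast
  interpret wave_semigroup D A E f c S
    using selfadjoint c E f_cont f_nonneg semigroup generator
    by unfold_locales auto
  show ?thesis
  proof
    assume st: "semiuniformly_stable N S domG G"
    obtain C where "\<And>s. s \<in> \<sigma> \<Longrightarrow> f s / s \<le> C" using bounded_quotient_of_stable [OF st] by blast
    then have "(SUP s\<in>\<sigma>. ereal (f s / s)) \<le> ereal C" by (intro SUP_least) simp
    then have "(SUP s\<in>\<sigma>. ereal (f s / s)) < \<infinity>" by (rule le_less_trans) simp
    then show "{s \<in> \<sigma>. f s = 0} = {} \<and> (SUP s\<in>\<sigma>. ereal (f s / s)) < \<infinity>"
      using zero_free_of_stable [OF st] by blast
  next
    assume *: "{s \<in> \<sigma>. f s = 0} = {} \<and> (SUP s\<in>\<sigma>. ereal (f s / s)) < \<infinity>"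
    then have "(SUP s\<in>\<sigma>. ereal (f s / s)) \<noteq> \<infinity>" by (metis less_irrefl)
    \<comment> \<open>A natural number as bound is automatically nonnegative, also when the supremum
      is negative infinity over an empty spectrum.\<close>
    then obtain n :: nat where n: "(SUP s\<in>\<sigma>. ereal (f s / s)) < ereal (real n)"
      unfolding less_PInf_Ex_of_nat by (elim exE)
    show "semiuniformly_stable N S domG G"
    proof (rule stable_of_bounded_quotient)
      fix s assume s: "s \<in> \<sigma>"
      show "0 < f s" using * f_nonneg s by (force simp: less_le)
      have "ereal (f s / s) < ereal (real n)" using SUP_lessD [OF n s] .
      then show "f s \<le> real n * s" using \<sigma>_ge [OF s] c(1) by (simp add: field_simps)
    qed simp
  qed
qed

end
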